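(* Let $\overline{d}=(d_1,\dots,d_n)$ be a tree degree sequence in non-increasing order. Among all trees with degree sequence $\overline{d}$, the greedy tree for $\overline{d}$ has the maximum connective eccentricity index.
   Context: For a vertex $x$ of a connected graph $H$, $d_H(x)$ is its degree and $\varepsilon_H(x)$ its eccentricity (maximum distance from $x$ to any vertex); the connective eccentricity index is $\xi^{ce}(H)=\sum_{x\in V(H)}\frac{d_H(x)}{\varepsilon_H(x)}$. In a rooted tree, the height of a vertex is its distance to the root; the level-degree sequence is the list of multisets $L_i$ of degrees of vertices at height $i$. The down-degree of the root is its degree, that of any other vertex is its degree minus one. The level-greedy rooted tree for a level-degree sequence: place $|L_i|$ vertices at level $i$, assign them from left to right the degrees of $L_i$ in non-increasing order; then for each level $i$ in turn, from left to right, join each vertex of level $i$ of down-degree $d$ to the first $d$ not-yet-connected vertices at level $i+1$. The greedy tree for the non-increasing tree degree sequence $(d_1,\dots,d_n)$ is the level-greedy tree for the level-degree sequence with $L_0=\{d_1\}$, $L_1=\{d_2,\dots,d_{d_1+1}\}$, and for each $i>1$, $|L_i|=\sum_{d\in L_{i-1}}(d-1)$, with every entry of $L_i$ at most every entry of $L_{i-1}$ (i.e., the degrees are distributed level by level taking the largest remaining ones). *)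

theory Defs
  imports "Graph_Theory.Graph_Theory" "HOL-Library.Multiset"
begin

text \<open>
  Finite simple graphs are rendered by the locale \<^locale>\<open>pair_graph\<close>: finite, loop-free,
  symmetric digraphs whose arcs are pairs of vertices.  As an edge \<open>{u,v}\<close> is represented by both
  \<open>(u,v)\<close> and \<open>(v,u)\<close>, the constant \<^const>\<open>tree\<close> of the library is not usable for
  such graphs: its notion of cycle admits the closed walk \<open>u,v,u\<close>.  Restricting cycles to length
  at least 3 gives the usual cycles of an undirected graph.
\<close>

definition undirected_tree :: "'a pair_pre_digraph \<Rightarrow> bool" where
  "undirected_tree G \<longleftrightarrow> pair_graph G \<and> connected (with_proj G) \<and>
     (\<nexists>p. pre_digraph.cycle (with_proj G) p \<and> length p \<ge> 3)"

text \<open>In a symmetric digraph the out-degree of a vertex is its degree as an undirected graph.\<close>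

abbreviation degree :: "'a pair_pre_digraph \<Rightarrow> 'a \<Rightarrow> nat" where
  "degree G \<equiv> out_degree (with_proj G)"

definition graph_dist :: "'a pair_pre_digraph \<Rightarrow> 'a \<Rightarrow> 'a \<Rightarrow> nat" where
  "graph_dist G u v = (LEAST k. \<exists>p. pre_digraph.awalk (with_proj G) u p v \<and> length p = k)"

definition eccentricity :: "'a pair_pre_digraph \<Rightarrow> 'a \<Rightarrow> nat" where
  "eccentricity G x = Max (graph_dist G x ` pverts G)"

text \<open>For the one-vertex graph the only summand is \<open>0 / 0\<close>, which is \<open>0\<close> in HOL.\<close>

definition connective_eccentricity_index :: "'a pair_pre_digraph \<Rightarrow> real" where
  "connective_eccentricity_index G =
     (\<Sum>x\<in>pverts G. real (degree G x) / real (eccentricity G x))"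

definition has_degree_sequence :: "'a pair_pre_digraph \<Rightarrow> nat list \<Rightarrow> bool" where
  "has_degree_sequence G d \<longleftrightarrow> image_mset (degree G) (mset_set (pverts G)) = mset d"

text \<open>Vertices of type \<^typ>\<open>nat\<close> are no restriction, as the trees are finite.\<close>

definition tree_degree_sequence :: "nat list \<Rightarrow> bool" where
  "tree_degree_sequence d \<longleftrightarrow>
     (\<exists>T :: nat pair_pre_digraph. undirected_tree T \<and> has_degree_sequence T d)"

text \<open>
  The vertex \<open>(i, j)\<close> of the level-greedy tree is the \<open>j\<close>-th one from the left
  (counting from 0) at level \<open>i\<close>.
\<close>

definition level_degree :: "nat multiset list \<Rightarrow> nat \<Rightarrow> nat \<Rightarrow> nat" where
  "level_degree Ls i j = rev (sorted_list_of_multiset (Ls ! i)) ! j"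

definition down_degree :: "nat multiset list \<Rightarrow> nat \<Rightarrow> nat \<Rightarrow> nat" where
  "down_degree Ls i j = (if i = 0 then level_degree Ls i j else level_degree Ls i j - 1)"

definition level_greedy_vertices :: "nat multiset list \<Rightarrow> (nat \<times> nat) set" where
  "level_greedy_vertices Ls = {(i, j). i < length Ls \<and> j < size (Ls ! i)}"

text \<open>
  When \<open>(i, j)\<close> is about to be joined to its children, the vertices to its left have used up
  exactly the first \<open>\<Sum>j'<j. down_degree Ls i j'\<close> vertices of level \<open>i + 1\<close>.
\<close>

definition level_greedy_arcs :: "nat multiset list \<Rightarrow> ((nat \<times> nat) \<times> (nat \<times> nat)) set" where
  "level_greedy_arcs Ls = {((i, j), (Suc i, k)) | i j k.
     (i, j) \<in> level_greedy_vertices Ls \<and> (Suc i, k) \<in> level_greedy_vertices Ls \<and>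
     (\<Sum>j'<j. down_degree Ls i j') \<le> k \<and>
     k < (\<Sum>j'<j. down_degree Ls i j') + down_degree Ls i j}"

definition level_greedy_tree :: "nat multiset list \<Rightarrow> (nat \<times> nat) pair_pre_digraph" where
  "level_greedy_tree Ls =
     \<lparr> pverts = level_greedy_vertices Ls,
       parcs = level_greedy_arcs Ls \<union> (level_greedy_arcs Ls)\<inverse> \<rparr>"

text \<open>
  \<open>greedy_levels w ds\<close> fills the levels below the root: \<open>w\<close> is the size of the next level and
  \<open>ds\<close> the non-increasing list of the degrees not yet used.  For a tree degree sequence the
  degrees run out exactly when \<open>w\<close> becomes 0; otherwise the leftover degrees are dropped.
\<close>

function greedy_levels :: "nat \<Rightarrow> nat list \<Rightarrow> nat multiset list" where
  "greedy_levels w ds =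
     (if w = 0 \<or> ds = [] then []
      else mset (take w ds) # greedy_levels (\<Sum>d\<leftarrow>take w ds. d - 1) (drop w ds))"
  by pat_completeness auto
termination
  by (relation "measure (\<lambda>(w, ds). length ds)") auto

declare greedy_levels.simps [simp del]

fun greedy_level_degree_sequence :: "nat list \<Rightarrow> nat multiset list" where
  "greedy_level_degree_sequence [] = []"
| "greedy_level_degree_sequence (d # ds) = {#d#} # greedy_levels d ds"

definition greedy_tree :: "nat list \<Rightarrow> (nat \<times> nat) pair_pre_digraph" where
  "greedy_tree d = level_greedy_tree (greedy_level_degree_sequence d)"

end

theory Submission
  imports Defs
begin

text \<open>
  Let \<open>r\<close> be the radius of a tree \<open>T\<close> with at least two vertices.  Its centre is a vertex or an edge,
  and every vertex at distance \<open>l\<close> from the centre has eccentricity \<open>r + l\<close>.  If \<open>B\<^sub>j\<close> is the set of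
  vertices at distance at most \<open>j\<close> from the centre, counting the arcs leaving \<open>B\<^sub>j\<close> gives
  \<open>|B\<^sub>j\<^sub>+\<^sub>1| + |B\<^sub>j| = 2 + (sum of the degrees in B\<^sub>j)\<close>, whether the centre is a vertex or an edge.
  So \<open>|B\<^sub>j\<^sub>+\<^sub>1|\<close> is at most \<open>f |B\<^sub>j|\<close>, where \<open>f m = 2 + (d\<^sub>1 - 1) + \<dots> + (d\<^sub>m - 1)\<close>.
  In the greedy tree, the balls around the root and around the edge from the root to its first child
  are initial segments of the breadth-first order, whose sizes satisfy this recurrence with equality.
  Comparing \<open>T\<close> with the balls of the same kind, their degree sums dominate
  those of the \<open>B\<^sub>j\<close>, the greedy tree lies within the same distance of its root or root edge as \<open>T\<close> of
  its centre, so its eccentricities are at most \<open>r + l\<close>, and summation by parts finishes the proof.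
  No relation between the diameters of the two trees is needed.
\<close>

section \<open>Distances in trees\<close>

locale connected_pair_graph = pair_graph G for G :: "'a pair_pre_digraph" +
  assumes connected: "connected (with_proj G)"
begin

lemma arc_sym: "(u, v) \<in> parcs G \<longleftrightarrow> (v, u) \<in> parcs G"
  by (blast intro: arcs_symmetric)

lemma pverts_nonempty: "pverts G \<noteq> {}"
  using connected by (auto simp: connected_def strongly_connected_def)

lemma ex_awalk:
  assumes "u \<in> pverts G" "v \<in> pverts G"
  shows "\<exists>p. awalk u p v"
proof -
  have "strongly_connected (with_proj G)"
    using symmetric_connected_imp_strongly_connected sym_arcs connected by blast
  then show ?thesis
    using assms by (auto simp: strongly_connected_def reachable_awalk)
qed

lemma ex_shortest_awalk:
  assumes "u \<in> pverts G" "v \<in> pverts G"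
  shows "\<exists>p. awalk u p v \<and> length p = graph_dist G u v"
  unfolding graph_dist_def using ex_awalk[OF assms] by - (rule LeastI_ex, blast)

lemma dist_le_length: "awalk u p v \<Longrightarrow> graph_dist G u v \<le> length p"
  unfolding graph_dist_def by (rule Least_le) blast

lemma dist_self [simp]: "u \<in> pverts G \<Longrightarrow> graph_dist G u u = 0"
  using dist_le_length[of u "[]" u] by (simp add: awalk_Nil_iff)

lemma dist_eq_0_iff:
  assumes "u \<in> pverts G" "v \<in> pverts G"
  shows "graph_dist G u v = 0 \<longleftrightarrow> u = v"
  using ex_shortest_awalk[OF assms] assms by (auto simp: awalk_Nil_iff)

lemma dist_commute:
  assumes "u \<in> pverts G" "v \<in> pverts G"
  shows "graph_dist G u v = graph_dist G v u"
proof -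
  have le: "graph_dist G v u \<le> graph_dist G u v" if uv: "u \<in> pverts G" "v \<in> pverts G" for u v
  proof -
    obtain p where p: "awalk u p v" "length p = graph_dist G u v"
      using ex_shortest_awalk[OF uv] by blast
    have "length (rev_path p) = length p"
      by (induct p) auto
    then show ?thesis
      using dist_le_length[of v "rev_path p" u] p by simp
  qed
  show ?thesis
    using le[OF assms] le[OF assms(2,1)] by simp
qed

lemma dist_triangle:
  assumes "u \<in> pverts G" "v \<in> pverts G" "w \<in> pverts G"
  shows "graph_dist G u w \<le> graph_dist G u v + graph_dist G v w"
proof -
  obtain p q where "awalk u p v" "length p = graph_dist G u v"
      "awalk v q w" "length q = graph_dist G v w"
    using ex_shortest_awalk assms by meson
  then show ?thesis
    using dist_le_length[of u "p @ q" w] by (auto intro: awalk_appendI)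
qed

lemma dist_arc: "(u, v) \<in> parcs G \<Longrightarrow> graph_dist G u v \<le> 1"
  using dist_le_length[of u "[(u, v)]" v] by (auto simp: awalk_simps dest: in_arcsD1 in_arcsD2)

lemma dist_arc_le:
  assumes "x \<in> pverts G" "(y, z) \<in> parcs G"
  shows "graph_dist G x z \<le> graph_dist G x y + 1"
  using dist_triangle[of x y z] dist_arc[OF assms(2)] in_arcsD1[OF assms(2)] in_arcsD2[OF assms(2)]
    assms(1) by simp

text \<open>The witness is the second vertex of a shortest walk from \<open>y\<close> to
  \<open>x\<close>; the triangle inequality shows that it is exactly one step closer.\<close>

lemma ex_closer_neighbour:
  assumes "x \<in> pverts G" "y \<in> pverts G" "x \<noteq> y"
  shows "\<exists>z. (y, z) \<in> parcs G \<and> graph_dist G x y = graph_dist G x z + 1"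
proof -
  obtain p where p: "awalk y p x" "length p = graph_dist G y x"
    using ex_shortest_awalk assms by meson
  with assms obtain a p' where "p = a # p'"
    by (cases p) (auto simp: awalk_Nil_iff)
  with p obtain z where z: "(y, z) \<in> parcs G" "awalk z p' x" "length p' + 1 = graph_dist G y x"
    by (cases a) (auto simp: awalk_Cons_iff)
  moreover have "z \<in> pverts G"
    using z(1) by (rule in_arcsD2)
  ultimately show ?thesis
    using dist_le_length[of z p' x] dist_arc_le[of x z y] assms dist_commute[of x]
    by (intro exI[of _ z]) (auto simp: arc_sym)
qed

lemma dist_le_eccentricity:
  assumes "y \<in> pverts G"
  shows "graph_dist G x y \<le> eccentricity G x"
  unfolding eccentricity_def using assms pair_finite_verts by (intro Max_ge) auto

lemma degree_eq_card: "degree G x = card {y. (x, y) \<in> parcs G}"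
proof -
  have "out_arcs (with_proj G) x = Pair x ` {y. (x, y) \<in> parcs G}"
    by (auto simp: out_arcs_def)
  then show ?thesis
    unfolding out_degree_def by (simp add: card_image inj_on_def)
qed

lemma finite_neighbours: "finite {y. (x, y) \<in> parcs G}"
  by (rule finite_subset[OF _ pair_finite_verts]) (auto dest: in_arcsD2)

lemma sum_degree_eq_card:
  assumes "finite B"
  shows "(\<Sum>x\<in>B. degree G x) = card {(x, y). x \<in> B \<and> (x, y) \<in> parcs G}"
proof -
  have "{(x, y). x \<in> B \<and> (x, y) \<in> parcs G} = (SIGMA x:B. {y. (x, y) \<in> parcs G})"
    by auto
  then show ?thesis
    using assms finite_neighbours by (simp add: degree_eq_card)
qed

lemma degree_pos:
  assumes "x \<in> pverts G" "card (pverts G) \<ge> 2"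
  shows "degree G x \<ge> 1"
proof -
  have "pverts G \<noteq> {x}"
    using assms(2) by auto
  then obtain y where "y \<in> pverts G" "y \<noteq> x"
    using assms(1) by auto
  then obtain z where "(x, z) \<in> parcs G"
    using ex_closer_neighbour[of y x] assms by auto
  then have "{y. (x, y) \<in> parcs G} \<noteq> {}"
    by blast
  then show ?thesis
    unfolding degree_eq_card using finite_neighbours by (simp add: Suc_le_eq card_gt_0_iff)
qed

end

section \<open>Consequences of acyclicity and the number of edges\<close>

locale tree_graph = connected_pair_graph +
  assumes no_cycle: "\<And>p. cycle p \<Longrightarrow> length p < 3"

lemma tree_graph_iff: "tree_graph G \<longleftrightarrow> undirected_tree G"
  unfolding undirected_tree_def tree_graph_def connected_pair_graph_def
    connected_pair_graph_axioms_def tree_graph_axioms_def by (auto simp: not_le)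

context tree_graph
begin

text \<open>A walk from \<open>z1\<close> to \<open>z2\<close> avoiding \<open>y\<close> could be
  thinned to a path, which closes up through \<open>y\<close> to a cycle; as
  \<open>z1 \<noteq> z2\<close>, its length is at least 3.\<close>

lemma not_joined_avoiding:
  assumes "(y, z1) \<in> parcs G" "(y, z2) \<in> parcs G" "z1 \<noteq> z2" "awalk z1 p z2"
  shows "y \<in> set (awalk_verts z1 p)"
proof (rule ccontr)
  assume y: "y \<notin> set (awalk_verts z1 p)"
  obtain q where q: "apath z1 q z2" "set q \<subseteq> set p"
    using apath_awalk_to_apath awalk_to_apath_subset assms(4) by metis
  then have aq: "awalk z1 q z2" and dq: "distinct (awalk_verts z1 q)"
    by (auto simp: apath_def)
  have yq: "y \<notin> set (awalk_verts z1 q)"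
    using y q(2) unfolding set_awalk_verts[OF aq] set_awalk_verts[OF assms(4)] by auto
  define c where "c = (y, z1) # q @ [(z2, y)]"
  have "q \<noteq> []"
    using aq assms(3) by (auto simp: awalk_Nil_iff)
  then have "length c \<ge> 3"
    by (cases q) (auto simp: c_def)
  have "(z2, y) \<in> parcs G"
    using assms(2) arc_sym by blast
  then have w: "awalk z1 (q @ [(z2, y)]) y"
    using aq by (auto simp: awalk_simps dest: in_arcsD1 in_arcsD2)
  then have "awalk y c y"
    using assms(1) by (auto simp: c_def awalk_Cons_iff dest: in_arcsD1 in_arcsD2)
  moreover have "awalk_verts z1 (q @ [(z2, y)]) = awalk_verts z1 q @ [y]"
    using awalk_verts_append[OF w] aq by simp
  then have "distinct (tl (awalk_verts y c))"
    using dq yq by (simp add: c_def)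
  ultimately have "cycle c"
    unfolding cycle_def by (intro exI[of _ y]) (auto simp: c_def)
  then show False
    using no_cycle[of c] \<open>length c \<ge> 3\<close> by simp
qed

text \<open>A shortest walk to \<open>x\<close> from a neighbour of \<open>y\<close> that is no
  farther from \<open>x\<close> cannot pass through \<open>y\<close>. Two such neighbours would thus
  be joined through \<open>x\<close> by a walk avoiding \<open>y\<close>. With \<open>\<le>\<close>
  instead of \<open><\<close>, the lemma also excludes neighbours at equal distance.\<close>

lemma nearer_neighbour_unique:
  assumes x: "x \<in> pverts G"
    and "(y, z1) \<in> parcs G" "(y, z2) \<in> parcs G"
    and "graph_dist G x z1 \<le> graph_dist G x y" "graph_dist G x z2 \<le> graph_dist G x y"
  shows "z1 = z2"
proof (rule ccontr)
  assume ne: "z1 \<noteq> z2"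
  have y: "y \<in> pverts G"
    using assms(2) by (rule in_arcsD1)
  have avoid: "\<exists>p. awalk z p x \<and> y \<notin> set (awalk_verts z p)"
    if z: "(y, z) \<in> parcs G" "graph_dist G x z \<le> graph_dist G x y" for z
  proof -
    have zV: "z \<in> pverts G" and "z \<noteq> y"
      using z(1) no_loops' by (auto dest: in_arcsD2)
    obtain p where p: "awalk z p x" "length p = graph_dist G z x"
      using ex_shortest_awalk zV x by meson
    have "y \<notin> set (awalk_verts z p)"
    proof
      assume "y \<in> set (awalk_verts z p)"
      then obtain q r where qr: "p = q @ r" "awalk z q y" "awalk y r x"
        using awalk_decomp[OF p(1)] by blast
      moreover have "q \<noteq> []"
        using qr \<open>z \<noteq> y\<close> by (auto simp: awalk_Nil_iff)
      ultimately have "graph_dist G y x < length p"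
        using dist_le_length[OF qr(3)] by (cases q) auto
      then show False
        using p z x y zV dist_commute by simp
    qed
    then show ?thesis
      using p by blast
  qed
  obtain p q where p: "awalk z1 p x" "y \<notin> set (awalk_verts z1 p)"
      and q: "awalk z2 q x" "y \<notin> set (awalk_verts z2 q)"
    using avoid assms by meson
  have q': "awalk x (rev_path q) z2" "y \<notin> set (awalk_verts x (rev_path q))"
    using q by (auto simp: awalk_verts_rev_path)
  have "awalk z1 (p @ rev_path q) z2"
    using p q' by auto
  moreover have "y \<notin> set (awalk_verts z1 (p @ rev_path q))"
    using set_awalk_verts_append[OF p(1) q'(1)] p q' by simp
  ultimately show False
    using not_joined_avoiding[OF assms(2,3) ne] by blast
qed

text \<open>Trees are bipartite: at equal distance, \<open>z\<close> and the neighbour of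
  \<open>y\<close> one step closer to \<open>x\<close> would both be no farther from
  \<open>x\<close> than \<open>y\<close>.\<close>

lemma dist_neighbour_neq:
  assumes "x \<in> pverts G" "(y, z) \<in> parcs G"
  shows "graph_dist G x z \<noteq> graph_dist G x y"
proof
  assume eq: "graph_dist G x z = graph_dist G x y"
  have V: "y \<in> pverts G" "z \<in> pverts G" and "y \<noteq> z"
    using assms no_loops' by (auto dest: in_arcsD1 in_arcsD2)
  have "x \<noteq> y"
    using eq V assms(1) \<open>y \<noteq> z\<close> dist_eq_0_iff[of x z] by auto
  then obtain w where "(y, w) \<in> parcs G" "graph_dist G x y = graph_dist G x w + 1"
    using ex_closer_neighbour assms V by blast
  then show False
    using nearer_neighbour_unique[of x y w z] eq assms by simp
qed

text \<open>Each vertex other than a root \<open>r\<close> has exactly one arc towards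
  \<open>r\<close>, and every arc is one of these or the converse of one.\<close>

lemma sum_degree: "(\<Sum>x\<in>pverts G. degree G x) + 2 = 2 * card (pverts G)"
proof -
  obtain r where r: "r \<in> pverts G"
    using pverts_nonempty by auto
  let ?d = "graph_dist G r"
  let ?D = "{(y, z). (y, z) \<in> parcs G \<and> ?d z < ?d y}"
  have fin: "finite ?D"
    by (rule finite_subset[OF _ pair_finite_arcs]) auto
  have "inj_on fst ?D"
    using nearer_neighbour_unique[OF r] by (fastforce simp: inj_on_def)
  moreover have "fst ` ?D = pverts G - {r}"
  proof
    show "fst ` ?D \<subseteq> pverts G - {r}"
      using r by (auto dest: in_arcsD1)
    show "pverts G - {r} \<subseteq> fst ` ?D"
      using ex_closer_neighbour[OF r] by force
  qed
  ultimately have D: "card ?D = card (pverts G) - 1"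
    using card_image[of fst ?D] r by simp
  have "{(x, y). x \<in> pverts G \<and> (x, y) \<in> parcs G} = ?D \<union> ?D\<inverse>"
    using dist_neighbour_neq[OF r] by (auto simp: arc_sym nat_neq_iff dest: in_arcsD1)
  moreover have "?D \<inter> ?D\<inverse> = {}"
    by auto
  moreover have "card (?D\<inverse>) = card ?D"
    by (rule card_inverse)
  moreover have "finite (?D\<inverse>)"
    using fin by (simp only: finite_converse)
  ultimately have "(\<Sum>x\<in>pverts G. degree G x) = 2 * (card (pverts G) - 1)"
    using fin D by (simp only: sum_degree_eq_card[OF pair_finite_verts] card_Un_disjoint)
  then show ?thesis
    using r pair_finite_verts by (cases "card (pverts G)") auto
qed

end

section \<open>Centre and level sizes\<close>

context tree_graph
begin

text \<open>Once a path leads away from \<open>x\<close>, it keeps doing so: \<open>w\<close> is the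
  only neighbour of \<open>z\<close> that is no farther from \<open>x\<close>, so the next step
  towards \<open>u\<close> increases the distance from \<open>x\<close> again.\<close>

lemma dist_add_towards:
  assumes "x \<in> pverts G" "u \<in> pverts G" "(w, z) \<in> parcs G"
    and "graph_dist G u w = graph_dist G u z + 1" "graph_dist G x z = graph_dist G x w + 1"
  shows "graph_dist G x u = graph_dist G x w + graph_dist G u w"
  using assms(3-)
proof (induction "graph_dist G u w" arbitrary: w z rule: less_induct)
  case less
  have V: "w \<in> pverts G" "z \<in> pverts G"
    using less.prems(1) by (blast dest: in_arcsD1 in_arcsD2)+
  show ?case
  proof (cases "z = u")
    case True
    then show ?thesis
      using less.prems assms by simp
  next
    case False
    then obtain z' where z': "(z, z') \<in> parcs G" "graph_dist G u z = graph_dist G u z' + 1"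
      using ex_closer_neighbour[of u z] assms V by auto
    have "(z, w) \<in> parcs G"
      using less.prems(1) arc_sym by blast
    moreover have "z' \<noteq> w"
      using z' less.prems by auto
    ultimately have "graph_dist G x z < graph_dist G x z'"
      using nearer_neighbour_unique[OF assms(1) z'(1), of w] less.prems
      by (metis le_add1 not_less)
    then have "graph_dist G x z' = graph_dist G x z + 1"
      using dist_arc_le[OF assms(1) z'(1)] by simp
    then have "graph_dist G x u = graph_dist G x z + graph_dist G u z"
      using less.hyps[of z z'] z' less.prems by simp
    then show ?thesis
      using less.prems by simp
  qed
qed

text \<open>The hypothesis \<open>w\<close> puts the vertex \<open>w\<close> on the path from
  \<open>u\<close> to \<open>v\<close>. Its neighbours \<open>y\<close> towards \<open>u\<close> and
  \<open>z\<close> towards \<open>v\<close> are distinct, so at least one of them is farther from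
  \<open>x\<close> than \<open>w\<close>, and \<open>dist_add_towards\<close> applies in that
  direction.\<close>

lemma dist_add_through:
  assumes V: "x \<in> pverts G" "u \<in> pverts G" "v \<in> pverts G" "w \<in> pverts G"
    and w: "graph_dist G u w + graph_dist G v w = graph_dist G u v"
  shows "graph_dist G x u = graph_dist G x w + graph_dist G u w \<or>
    graph_dist G x v = graph_dist G x w + graph_dist G v w"
proof (cases "w = u \<or> w = v")
  case True
  then show ?thesis
    using V by auto
next
  case False
  obtain y z where y: "(w, y) \<in> parcs G" "graph_dist G u w = graph_dist G u y + 1"
    and z: "(w, z) \<in> parcs G" "graph_dist G v w = graph_dist G v z + 1"
    using ex_closer_neighbour False V by metis
  have "y \<in> pverts G"
    using y(1) by (rule in_arcsD2)
  then have "y \<noteq> z"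
    using dist_triangle[of u y v] dist_commute[of y v] V w y(2) z(2) by auto
  then have "graph_dist G x w < graph_dist G x y \<or> graph_dist G x w < graph_dist G x z"
    using nearer_neighbour_unique[OF V(1) y(1) z(1)] by (meson not_le)
  then have "graph_dist G x y = graph_dist G x w + 1 \<or> graph_dist G x z = graph_dist G x w + 1"
    using dist_arc_le[OF V(1) y(1)] dist_arc_le[OF V(1) z(1)] by auto
  then show ?thesis
    using dist_add_towards[OF V(1,2) y] dist_add_towards[OF V(1,3) z] by blast
qed

end

section \<open>Diametral paths, the centre and the sizes of balls around it\<close>

context connected_pair_graph
begin

lemma ex_on_geodesic:
  assumes "u \<in> pverts G" "v \<in> pverts G" "k \<le> graph_dist G u v"
  shows "\<exists>w\<in>pverts G. graph_dist G u w = k \<and> graph_dist G v w = graph_dist G u v - k"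
  using assms(3)
proof (induction k)
  case 0
  then show ?case
    using assms dist_commute by (intro bexI[of _ u]) auto
next
  case (Suc k)
  then obtain w where w: "w \<in> pverts G" "graph_dist G u w = k" "graph_dist G v w = graph_dist G u v - k"
    by auto
  with Suc.prems have "w \<noteq> v"
    using assms by auto
  then obtain z where z: "(w, z) \<in> parcs G" "graph_dist G v w = graph_dist G v z + 1"
    using ex_closer_neighbour assms w by metis
  have zV: "z \<in> pverts G"
    using z(1) by (rule in_arcsD2)
  have "graph_dist G u z \<le> k + 1"
    using dist_arc_le[OF assms(1) z(1)] w by simp
  moreover have "graph_dist G u v \<le> graph_dist G u z + graph_dist G v z"
    using dist_triangle[of u z v] dist_commute[of z v] zV assms by simp
  ultimately show ?case
    using zV z(2) w Suc.prems by (intro bexI[of _ z]) auto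
qed

lemma ex_diametral:
  "\<exists>u\<in>pverts G. \<exists>v\<in>pverts G. \<forall>x\<in>pverts G. eccentricity G x \<le> graph_dist G u v"
proof -
  have fin: "finite (eccentricity G ` pverts G)" and ne: "eccentricity G ` pverts G \<noteq> {}"
    using pair_finite_verts pverts_nonempty by auto
  obtain u where u: "u \<in> pverts G" "eccentricity G u = Max (eccentricity G ` pverts G)"
    using Max_in[OF fin ne] by force
  have "eccentricity G u \<in> graph_dist G u ` pverts G"
    unfolding eccentricity_def using pair_finite_verts pverts_nonempty by (intro Max_in) auto
  then obtain v where "v \<in> pverts G" "eccentricity G u = graph_dist G u v"
    by auto
  then show ?thesis
    using u Max_ge[OF fin] by (metis imageI)
qed

end

text \<open>The centre is the middle of a diametral path: a vertex if the diameter is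
  \<open>2 * r\<close>, an edge if it is \<open>2 * r - 1\<close>. From any \<open>x\<close>, the
  path to one end of the diametral path runs through the middle, which bounds the eccentricity from
  below; comparison with the diameter then bounds the level of \<open>x\<close> by \<open>r\<close>
  or \<open>r - 1\<close>. The summand \<open>card {c1, c2}\<close> unites the two bounds.\<close>

lemma (in tree_graph) ex_centre:
  assumes "card (pverts G) \<ge> 2"
  obtains c1 c2 r where "c1 \<in> pverts G" "c2 \<in> pverts G" "c1 = c2 \<or> (c1, c2) \<in> parcs G" "r > 0"
    and "\<And>x. x \<in> pverts G \<Longrightarrow>
      r + min (graph_dist G c1 x) (graph_dist G c2 x) \<le> eccentricity G x"
    and "\<And>x. x \<in> pverts G \<Longrightarrow>
      min (graph_dist G c1 x) (graph_dist G c2 x) + card {c1, c2} \<le> r + 1"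
proof -
  obtain u v where u: "u \<in> pverts G" and v: "v \<in> pverts G"
    and diam: "\<And>x. x \<in> pverts G \<Longrightarrow> eccentricity G x \<le> graph_dist G u v"
    using ex_diametral by blast
  let ?D = "graph_dist G u v"
  have "?D > 0"
  proof (rule ccontr)
    assume "\<not> ?D > 0"
    then have "x = y" if "x \<in> pverts G" "y \<in> pverts G" for x y
      using diam[OF that(1)] dist_le_eccentricity[OF that(2), of x] dist_eq_0_iff[OF that] by simp
    then have "pverts G \<subseteq> {u}"
      using u by auto
    then show False
      using assms card_mono[of "{u}" "pverts G"] by simp
  qed
  have ecc: "graph_dist G x u \<le> eccentricity G x" "graph_dist G x v \<le> eccentricity G x" for x
    using dist_le_eccentricity u v by auto
  show ?thesis
  proof (cases "even ?D")
    case True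
    then obtain r where r: "?D = 2 * r"
      by (elim evenE)
    obtain c where c: "c \<in> pverts G" "graph_dist G u c = r" "graph_dist G v c = r"
      using ex_on_geodesic[OF u v, of r] r by auto
    have far: "r + graph_dist G c x \<le> eccentricity G x" if "x \<in> pverts G" for x
      using dist_add_through[OF that u v c(1)] c r ecc[of x] dist_commute[OF c(1) that] by auto
    have "graph_dist G c x \<le> r" if "x \<in> pverts G" for x
      using far[OF that] diam[OF that] r by simp
    then show ?thesis
      using far c(1) r \<open>?D > 0\<close> by (intro that[of c c r]) auto
  next
    case False
    then obtain s where s: "?D = 2 * s + 1"
      by (elim oddE)
    obtain c1 where c1: "c1 \<in> pverts G" "graph_dist G u c1 = s" "graph_dist G v c1 = s + 1"
      using ex_on_geodesic[OF u v, of s] s by auto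
    then obtain c2 where arc: "(c1, c2) \<in> parcs G" and c2v: "graph_dist G v c2 = s"
      using ex_closer_neighbour[of v c1] v dist_eq_0_iff[of v c1] by fastforce
    have c2: "c2 \<in> pverts G"
      using arc by (rule in_arcsD2)
    have c2u: "graph_dist G u c2 = s + 1"
      using dist_arc_le[OF u arc] dist_triangle[OF u c2 v] dist_commute[OF c2 v] c1 c2v s by simp
    have "c1 \<noteq> c2"
      using c1 c2u by auto
    have far: "s + 1 + min (graph_dist G c1 x) (graph_dist G c2 x) \<le> eccentricity G x"
      if x: "x \<in> pverts G" for x
    proof -
      have "graph_dist G x u = graph_dist G x c1 + s \<or>
          graph_dist G x v = graph_dist G x c1 + (s + 1)"
        using dist_add_through[OF x u v c1(1)] c1 s by simp
      moreover have "graph_dist G x u = graph_dist G x c2 + (s + 1) \<or>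
          graph_dist G x v = graph_dist G x c2 + s"
        using dist_add_through[OF x u v c2] c2u c2v s by simp
      \<comment> \<open>This settles the case in which the disjunctions give the distances to
        \<open>c1\<close> and \<open>c2\<close> plus \<open>s\<close> each: the larger of two
        distinct distances is at least the smaller plus 1.\<close>
      moreover have "graph_dist G x c1 \<noteq> graph_dist G x c2"
        using dist_neighbour_neq[OF x arc] by simp
      ultimately show ?thesis
        using ecc[of x] dist_commute[OF c1(1) x] dist_commute[OF c2 x] by auto
    qed
    have "min (graph_dist G c1 x) (graph_dist G c2 x) + 2 \<le> s + 1 + 1" if "x \<in> pverts G" for x
      using far[OF that] diam[OF that] s by linarith
    then show ?thesis
      using far c1(1) c2 arc \<open>c1 \<noteq> c2\<close> by (intro that[of c1 c2 "s + 1"]) auto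
  qed
qed

text \<open>Three disjoint families of arcs start in \<open>B j\<close>: from its noncentral
  vertices to their parents (\<open>?U\<close>), from parents to the noncentral vertices of
  \<open>B (Suc j)\<close> (\<open>?D\<close>), and along the central edge in both directions
  (\<open>?M\<close>). With \<open>s = card {c1, c2}\<close> their sizes are
  \<open>card (B j) - s\<close>, \<open>card (B (Suc j)) - s\<close> and
  \<open>2 * s - 2\<close>.\<close>

lemma (in connected_pair_graph) card_levels_le:
  fixes c1 c2 j
  defines "lev x \<equiv> min (graph_dist G c1 x) (graph_dist G c2 x)"
  defines "B i \<equiv> {x \<in> pverts G. lev x \<le> i}"
  assumes c: "c1 \<in> pverts G" "c2 \<in> pverts G" "c1 = c2 \<or> (c1, c2) \<in> parcs G"
  shows "card (B j) + card (B (Suc j)) \<le> 2 + (\<Sum>x\<in>B j. degree G x)"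
proof -
  have lev0: "lev x = 0 \<longleftrightarrow> x \<in> {c1, c2}" if "x \<in> pverts G" for x
    using dist_eq_0_iff c that by (auto simp: lev_def min_def)
  have step: "lev z \<le> lev y + 1" if "(y, z) \<in> parcs G" for y z
    using dist_arc_le[OF _ that] c(1,2) unfolding lev_def by (fastforce simp: min_def)
  have "\<exists>z. (x, z) \<in> parcs G \<and> lev z < lev x" if x: "x \<in> pverts G - {c1, c2}" for x
  proof -
    obtain c where "c \<in> {c1, c2}" "lev x = graph_dist G c x"
      unfolding lev_def by (cases "graph_dist G c1 x \<le> graph_dist G c2 x") auto
    moreover from this obtain z where "(x, z) \<in> parcs G" "graph_dist G c x = graph_dist G c z + 1"
      using ex_closer_neighbour[of c x] x c by blast
    ultimately show ?thesis
      by (intro exI[of _ z]) (auto simp: lev_def)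
  qed
  then obtain par where par: "\<And>x. x \<in> pverts G - {c1, c2} \<Longrightarrow> (x, par x) \<in> parcs G \<and> lev (par x) < lev x"
    by metis
  let ?A = "{(x, y). x \<in> B j \<and> (x, y) \<in> parcs G}"
  let ?U = "(\<lambda>y. (y, par y)) ` (B j - {c1, c2})"
  let ?D = "(\<lambda>y. (par y, y)) ` (B (Suc j) - {c1, c2})"
  \<comment> \<open>Removing \<open>(c1, c1)\<close> makes this empty when the centre is a single
    vertex.\<close>
  let ?M = "{(c1, c2), (c2, c1)} - {(c1, c1)}"
  have finB: "finite (B j)" for j
    using pair_finite_verts by (simp add: B_def)
  have C: "{c1, c2} \<subseteq> B j" for j
    using c(1,2) lev0[OF c(1)] lev0[OF c(2)] by (simp add: B_def)
  have "finite ?A"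
    by (rule finite_subset[OF _ pair_finite_arcs]) auto
  moreover have "?U \<union> ?D \<union> ?M \<subseteq> ?A"
  proof -
    have "?U \<subseteq> ?A"
      using par by (auto simp: B_def)
    moreover have "?D \<subseteq> ?A"
      using par by (force simp: B_def arc_sym dest: in_arcsD1 in_arcsD2)
    moreover have "?M \<subseteq> ?A"
      using C c(3) arc_sym by auto
    ultimately show ?thesis
      by blast
  qed
  ultimately have "card (?U \<union> ?D \<union> ?M) \<le> card ?A"
    by (rule card_mono)
  moreover have "card (?U \<union> ?D \<union> ?M) = card ?U + card ?D + card ?M"
  proof -
    have "lev b < lev a" if "(a, b) \<in> ?U" for a b
      using that par by (auto simp: B_def)
    moreover have "lev a < lev b" if "(a, b) \<in> ?D" for a b
      using that par by (auto simp: B_def)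
    ultimately have "?U \<inter> ?D = {}"
      by fastforce
    moreover have "(?U \<union> ?D) \<inter> ?M = {}"
      by auto
    ultimately show ?thesis
      using finB by (simp add: card_Un_disjoint)
  qed
  moreover have "card ?U = card (B j) - card {c1, c2}"
    by (subst card_image) (use C in \<open>auto simp: inj_on_def card_Diff_subset\<close>)
  moreover have "card ?D = card (B (Suc j)) - card {c1, c2}"
    by (subst card_image) (use C in \<open>auto simp: inj_on_def card_Diff_subset\<close>)
  moreover have "card ?M + 2 = 2 * card {c1, c2}"
    by (cases "c1 = c2") (auto simp: insert_Diff_if)
  moreover have "card {c1, c2} \<le> card (B j)" "card {c1, c2} \<le> card (B (Suc j))"
    using C finB by (auto intro!: card_mono simp del: insert_subset)
  moreover have "(\<Sum>x\<in>B j. degree G x) = card ?A"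
    using finB by (rule sum_degree_eq_card)
  ultimately show ?thesis
    by linarith
qed

section \<open>Comparison with the breadth-first levels\<close>

text \<open>Abel summation: \<open>\<phi> l\<close> is \<open>\<phi> R\<close> plus the differences
  \<open>\<phi> j - \<phi> (Suc j)\<close> for \<open>l \<le> j < R\<close>; then the order of
  summation is exchanged.\<close>

lemma sum_by_levels:
  fixes w :: "'b \<Rightarrow> real" and \<phi> :: "nat \<Rightarrow> real"
  assumes "finite X" "\<And>x. x \<in> X \<Longrightarrow> lev x \<le> R"
  shows "(\<Sum>x\<in>X. w x * \<phi> (lev x)) =
    \<phi> R * (\<Sum>x\<in>X. w x) + (\<Sum>j<R. (\<phi> j - \<phi> (Suc j)) * (\<Sum>x | x \<in> X \<and> lev x \<le> j. w x))"
proof -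
  have tele: "\<phi> l = \<phi> R + (\<Sum>j<R. if l \<le> j then \<phi> j - \<phi> (Suc j) else 0)" if "l \<le> R" for l
  proof -
    have "(\<Sum>j<R. if l \<le> j then \<phi> j - \<phi> (Suc j) else 0) = (\<Sum>j\<in>{l..<R}. \<phi> j - \<phi> (Suc j))"
      by (rule sum.mono_neutral_cong_right) auto
    also have "\<dots> = \<phi> l - \<phi> R"
      using sum_Suc_diff'[OF that, of "\<lambda>j. - \<phi> j"] by (simp add: sum_subtractf)
    finally show ?thesis
      by simp
  qed
  have "(\<Sum>x\<in>X. w x * \<phi> (lev x)) =
      (\<Sum>x\<in>X. \<phi> R * w x + (\<Sum>j<R. (\<phi> j - \<phi> (Suc j)) * (if lev x \<le> j then w x else 0)))"
  proof (rule sum.cong[OF refl])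
    fix x assume "x \<in> X"
    have "w x * \<phi> (lev x) = \<phi> R * w x + w x * (\<Sum>j<R. if lev x \<le> j then \<phi> j - \<phi> (Suc j) else 0)"
      using tele[OF assms(2)[OF \<open>x \<in> X\<close>]] by (metis distrib_left mult.commute)
    also have "w x * (\<Sum>j<R. if lev x \<le> j then \<phi> j - \<phi> (Suc j) else 0) =
        (\<Sum>j<R. (\<phi> j - \<phi> (Suc j)) * (if lev x \<le> j then w x else 0))"
      unfolding sum_distrib_left by (rule sum.cong) auto
    finally show "w x * \<phi> (lev x) =
        \<phi> R * w x + (\<Sum>j<R. (\<phi> j - \<phi> (Suc j)) * (if lev x \<le> j then w x else 0))" .
  qed
  also have "\<dots> = \<phi> R * (\<Sum>x\<in>X. w x) +
      (\<Sum>j<R. \<Sum>x\<in>X. (\<phi> j - \<phi> (Suc j)) * (if lev x \<le> j then w x else 0))"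
    by (simp only: sum.distrib sum_distrib_left sum.swap[of _ "{..<R}" X])
  also have "\<dots> = \<phi> R * (\<Sum>x\<in>X. w x) +
      (\<Sum>j<R. (\<phi> j - \<phi> (Suc j)) * (\<Sum>x | x \<in> X \<and> lev x \<le> j. w x))"
    using assms(1) by (simp add: sum_distrib_left[symmetric] sum.If_cases Int_def)
  finally show ?thesis .
qed

text \<open>For decreasing \<open>\<phi>\<close> the coefficients in \<open>sum_by_levels\<close>
  are nonnegative, so it suffices to compare the weights of the balls.\<close>

lemma sum_by_levels_mono:
  fixes v w :: "_ \<Rightarrow> real" and \<phi> :: "nat \<Rightarrow> real"
  assumes "finite X" "\<And>x. x \<in> X \<Longrightarrow> lev x \<le> R"
    and "finite Y" "\<And>y. y \<in> Y \<Longrightarrow> lev' y \<le> R"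
    and "sum w X = sum v Y"
    and "\<And>j. j < R \<Longrightarrow> (\<Sum>x | x \<in> X \<and> lev x \<le> j. w x) \<le> (\<Sum>y | y \<in> Y \<and> lev' y \<le> j. v y)"
    and "\<And>j. j < R \<Longrightarrow> \<phi> (Suc j) \<le> \<phi> j"
  shows "(\<Sum>x\<in>X. w x * \<phi> (lev x)) \<le> (\<Sum>y\<in>Y. v y * \<phi> (lev' y))"
proof -
  have "(\<Sum>j<R. (\<phi> j - \<phi> (Suc j)) * (\<Sum>x | x \<in> X \<and> lev x \<le> j. w x)) \<le>
      (\<Sum>j<R. (\<phi> j - \<phi> (Suc j)) * (\<Sum>y | y \<in> Y \<and> lev' y \<le> j. v y))"
    using assms(6,7) by (intro sum_mono mult_left_mono) auto
  then show ?thesis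
    using assms(5) sum_by_levels[where lev = lev and w = w and \<phi> = \<phi>, OF assms(1,2)]
      sum_by_levels[where lev = lev' and w = v and \<phi> = \<phi>, OF assms(3,4)] by simp
qed

text \<open>Induction on \<open>d\<close>: a head that lies in \<open>M\<close> is removed from both
  sides; otherwise \<open>M\<close> lies in the tail, and putting the largest entry in front does
  not decrease a prefix sum.\<close>

lemma sum_mset_le_sum_list_take:
  fixes d :: "nat list"
  assumes "sorted_wrt (\<ge>) d" "M \<subseteq># mset d"
  shows "sum_mset M \<le> sum_list (take (size M) d)"
  using assms
proof (induction d arbitrary: M)
  case Nil
  then show ?case
    by simp
next
  case (Cons a d)
  show ?case
  proof (cases "a \<in># M")
    case True
    then obtain N where N: "M = add_mset a N"
      by (metis insert_DiffM)
    then show ?thesis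
      using Cons.IH[of N] Cons.prems by simp
  next
    case False
    then have M: "M \<subseteq># mset d"
      using Cons.prems(2) by (metis diff_single_trivial mset.simps(2)
          subset_eq_diff_conv add_mset_add_single)
    have le: "sum_list (take k d) \<le> sum_list (take k (a # d))" for k
    proof (cases k)
      case (Suc k')
      show ?thesis
      proof (cases "k' < length d")
        case True
        then have "d ! k' \<le> a"
          using Cons.prems(1) by simp
        then show ?thesis
          using Suc True by (simp add: take_Suc_conv_app_nth)
      qed (use Suc in simp)
    qed simp
    show ?thesis
      using Cons.IH[OF _ M] Cons.prems(1) le[of "size M"] by simp
  qed
qed

lemma sum_list_take_eq_sum:
  fixes d :: "nat list"
  assumes "m \<le> length d"
  shows "sum_list (take m d) = (\<Sum>i<m. d ! i)"
  using assms by (simp add: sum_list_sum_nth lessThan_atLeast0)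

section \<open>Growth of balls in breadth-first order\<close>

text \<open>
  Number the vertices of the greedy tree from 0 in breadth-first order.  With the edge between 0 and 1
  as root, the children of the vertices below \<open>m\<close> are the vertices from 2 up to \<open>reach d m\<close>, excluded.
  Iterating \<open>reach d\<close> from \<open>s = 1\<close> gives the sizes of the balls around the root vertex, from
  \<open>s = 2\<close> those of the balls around the root edge.
\<close>

definition reach :: "nat list \<Rightarrow> nat \<Rightarrow> nat" where
  "reach d m = 2 + (\<Sum>i<m. d ! i - 1)"

text \<open>The distance of the \<open>i\<close>-th vertex from the root vertex
  (\<open>s = 1\<close>) or the root edge (\<open>s = 2\<close>): the least radius of a ball that
  contains it.\<close>

definition bfs_level :: "nat list \<Rightarrow> nat \<Rightarrow> nat \<Rightarrow> nat" where
  "bfs_level d s i = (LEAST j. i < (reach d ^^ j) s)"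

lemma reach_Suc: "reach d (Suc m) = reach d m + (d ! m - 1)"
  by (simp add: reach_def)

lemma mono_reach: "mono (reach d)"
  unfolding incseq_Suc_iff by (simp add: reach_Suc)

text \<open>The numerical properties of the degree sequence of a tree with at least two vertices.
  Positivity makes the truncated subtraction in \<open>reach\<close> exact.\<close>

locale tree_degrees =
  fixes d :: "nat list"
  assumes length_ge_2: "length d \<ge> 2"
    and pos: "\<And>x. x \<in> set d \<Longrightarrow> x \<ge> 1"
    and sum_list_eq: "sum_list d + 2 = 2 * length d"
    and sorted: "sorted_wrt (\<ge>) d"
begin

lemma nth_ge_1: "i < length d \<Longrightarrow> d ! i \<ge> 1"
  using pos by simp

lemma reach_add:
  assumes "m \<le> length d"
  shows "reach d m + m = 2 + (\<Sum>i<m. d ! i)"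
proof -
  have "(\<Sum>i<m. d ! i - 1) + (\<Sum>i<m. 1) = (\<Sum>i<m. d ! i)"
    unfolding sum.distrib[symmetric]
  proof (rule sum.cong[OF refl])
    fix i assume "i \<in> {..<m}"
    then show "d ! i - 1 + 1 = d ! i"
      using nth_ge_1[of i] assms by simp
  qed
  then show ?thesis
    by (simp add: reach_def)
qed

text \<open>The degree sum of a tree makes \<open>length d\<close> a fixed point of
  \<open>reach d\<close>; by monotonicity, no iterate started below it can exceed it.\<close>

lemma reach_length: "reach d (length d) = length d"
  using reach_add[of "length d"] sum_list_eq sum_list_take_eq_sum[of "length d" d] by simp

lemma reach_le: "m \<le> length d \<Longrightarrow> reach d m \<le> length d"
  using monoD[OF mono_reach] reach_length by metis

lemma funpow_reach_le: "s \<le> length d \<Longrightarrow> (reach d ^^ j) s \<le> length d"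
  by (induction j) (auto intro: reach_le)

text \<open>If \<open>d ! m \<ge> 2\<close>, the first \<open>m\<close> summands of \<open>reach d m\<close> are positive;
  otherwise the summands from \<open>m\<close> on vanish.\<close>

lemma less_reach:
  assumes "m < length d"
  shows "m < reach d m"
proof (cases "d ! m \<ge> 2")
  case True
  have "(\<Sum>i<m. 1) \<le> (\<Sum>i<m. d ! i - 1)"
  proof (rule sum_mono)
    fix i assume "i \<in> {..<m}"
    then have "d ! m \<le> d ! i"
      using sorted assms by (simp add: sorted_wrt_iff_nth_less)
    then show "1 \<le> d ! i - 1"
      using True by simp
  qed
  then show ?thesis
    by (simp add: reach_def)
next
  case False
  have "reach d k = reach d m" if "m \<le> k" "k \<le> length d" for k
    using that
  proof (induction k rule: dec_induct)
    case (step k)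
    have "d ! k \<le> d ! m"
      using step sorted by (cases "k = m") (auto simp: sorted_wrt_iff_nth_less)
    then show ?case
      using step False by (simp add: reach_Suc)
  qed simp
  then show ?thesis
    using assms reach_length by (metis le_refl less_imp_le)
qed

text \<open>By \<open>less_reach\<close> the iterates increase until they stop at
  \<open>length d\<close>, so once an index is covered it stays covered. The hypothesis on
  \<open>R\<close> ensures that the least radius exists.\<close>

lemma bfs_level_le_iff:
  assumes "s \<le> length d" "i < length d" "(reach d ^^ R) s \<ge> length d"
  shows "bfs_level d s i \<le> j \<longleftrightarrow> i < (reach d ^^ j) s"
proof
  have mono: "(reach d ^^ k) s \<le> (reach d ^^ Suc k) s" for k
    using less_reach[of "(reach d ^^ k) s"] funpow_reach_le[OF assms(1), of k] reach_length
    by (cases "(reach d ^^ k) s = length d") auto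
  have "i < (reach d ^^ R) s"
    using assms by simp
  then have "i < (reach d ^^ bfs_level d s i) s"
    unfolding bfs_level_def by (rule LeastI)
  moreover assume "bfs_level d s i \<le> j"
  then have "(reach d ^^ bfs_level d s i) s \<le> (reach d ^^ j) s"
    using mono by (rule lift_Suc_mono_le[of "\<lambda>k. (reach d ^^ k) s", rotated])
  ultimately show "i < (reach d ^^ j) s"
    by simp
next
  show "i < (reach d ^^ j) s \<Longrightarrow> bfs_level d s i \<le> j"
    unfolding bfs_level_def by (rule Least_le)
qed

end

text \<open>The degrees in \<open>B j\<close> sum to at most the \<open>card (B j)\<close> largest
  entries of \<open>d\<close>. Hence \<open>card_levels_le\<close> bounds
  \<open>card (B (Suc j))\<close> by \<open>reach d (card (B j))\<close>, and monotonicity bounds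
  the balls by the iterates of \<open>reach d\<close> from \<open>s\<close>. As radius
  \<open>r + 1 - s\<close> exhausts the tree, the iterates reach \<open>length d\<close> within as
  many steps.\<close>

lemma (in tree_graph) connective_eccentricity_index_le:
  assumes "tree_degrees d" "has_degree_sequence G d"
  obtains s r where "s \<in> {1, 2}" "r > 0" "(reach d ^^ (r + 1 - s)) s \<ge> length d"
    and "connective_eccentricity_index G \<le>
      (\<Sum>i<length d. real (d ! i) / real (r + bfs_level d s i))"
proof -
  interpret tree_degrees d
    by fact
  have deg: "image_mset (degree G) (mset_set (pverts G)) = mset d"
    using assms(2) by (simp add: has_degree_sequence_def)
  have card: "card (pverts G) = length d"
    using arg_cong[OF deg, of size] by simp
  obtain c1 c2 r where c: "c1 \<in> pverts G" "c2 \<in> pverts G" "c1 = c2 \<or> (c1, c2) \<in> parcs G" and "r > 0"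
    and far: "\<And>x. x \<in> pverts G \<Longrightarrow>
      r + min (graph_dist G c1 x) (graph_dist G c2 x) \<le> eccentricity G x"
    and near: "\<And>x. x \<in> pverts G \<Longrightarrow>
      min (graph_dist G c1 x) (graph_dist G c2 x) + card {c1, c2} \<le> r + 1"
    using ex_centre card length_ge_2 by metis
  define lev where "lev x = min (graph_dist G c1 x) (graph_dist G c2 x)" for x
  define B where "B j = {x \<in> pverts G. lev x \<le> j}" for j
  define s where "s = card {c1, c2}"
  have s: "s \<in> {1, 2}"
    by (cases "c1 = c2") (auto simp: s_def)
  have s_le: "s \<le> length d"
    using s length_ge_2 by auto
  let ?R = "r + 1 - s"
  have levR: "lev x \<le> ?R" if "x \<in> pverts G" for x
    using near[OF that] by (simp add: lev_def s_def)
  have cardB: "card (B j) \<le> length d" for j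
    unfolding card[symmetric] B_def using pair_finite_verts by (intro card_mono) auto
  have sumB: "(\<Sum>x\<in>B j. degree G x) \<le> (\<Sum>i<card (B j). d ! i)" for j
  proof -
    have "mset_set (B j) \<subseteq># mset_set (pverts G)"
      using pair_finite_verts by (simp add: B_def)
    then have "image_mset (degree G) (mset_set (B j)) \<subseteq># mset d"
      unfolding deg[symmetric] by (rule image_mset_subseteq_mono)
    then have "(\<Sum>x\<in>B j. degree G x) \<le> sum_list (take (card (B j)) d)"
      using sum_mset_le_sum_list_take[OF sorted] by (fastforce simp: sum_unfold_sum_mset)
    then show ?thesis
      using cardB by (simp add: sum_list_take_eq_sum)
  qed
  have B_le: "card (B j) \<le> (reach d ^^ j) s" for j
  proof (induction j)
    case 0
    have "B 0 \<subseteq> {c1, c2}"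
      using dist_eq_0_iff c by (auto simp: B_def lev_def min_def split: if_splits)
    then show ?case
      by (simp add: s_def card_mono)
  next
    case (Suc j)
    have "card (B j) + card (B (Suc j)) \<le> 2 + (\<Sum>x\<in>B j. degree G x)"
      using card_levels_le[OF c, of j] unfolding B_def lev_def .
    then have "card (B (Suc j)) \<le> reach d (card (B j))"
      using sumB[of j] reach_add[OF cardB[of j]] by simp
    also have "\<dots> \<le> reach d ((reach d ^^ j) s)"
      by (rule monoD[OF mono_reach Suc])
    finally show ?case
      by simp
  qed
  have "B ?R = pverts G"
    using levR by (auto simp: B_def)
  then have full: "(reach d ^^ ?R) s \<ge> length d"
    using B_le[of ?R] card by simp
  note lev_iff = bfs_level_le_iff[OF s_le _ full]
  have "connective_eccentricity_index G \<le> (\<Sum>x\<in>pverts G. real (degree G x) * (1 / real (r + lev x)))"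
    unfolding connective_eccentricity_index_def
  proof (rule sum_mono)
    fix x assume "x \<in> pverts G"
    then have "r + lev x \<le> eccentricity G x"
      using far by (simp add: lev_def)
    then show "real (degree G x) / real (eccentricity G x) \<le> real (degree G x) * (1 / real (r + lev x))"
      using \<open>r > 0\<close> by (simp add: frac_le)
  qed
  also have "\<dots> \<le> (\<Sum>i\<in>{..<length d}. real (d ! i) * (1 / real (r + bfs_level d s i)))"
  proof (rule sum_by_levels_mono[where R = ?R and \<phi> = "\<lambda>l. 1 / real (r + l)"])
    show "finite (pverts G)"
      by (rule pair_finite_verts)
    show "bfs_level d s i \<le> ?R" if "i \<in> {..<length d}" for i
      using lev_iff that full by simp
    have "(\<Sum>x\<in>pverts G. degree G x) = sum_mset (mset d)"
      unfolding deg[symmetric] by (simp add: sum_unfold_sum_mset)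
    also have "\<dots> = (\<Sum>i<length d. d ! i)"
      by (simp add: sum_mset_sum_list sum_list_sum_nth lessThan_atLeast0)
    finally show "(\<Sum>x\<in>pverts G. real (degree G x)) = (\<Sum>i\<in>{..<length d}. real (d ! i))"
      by (metis of_nat_sum)
    show "(\<Sum>x | x \<in> pverts G \<and> lev x \<le> j. real (degree G x)) \<le>
        (\<Sum>i | i \<in> {..<length d} \<and> bfs_level d s i \<le> j. real (d ! i))" for j
    proof -
      have "{i \<in> {..<length d}. bfs_level d s i \<le> j} = {..<(reach d ^^ j) s}"
        using lev_iff funpow_reach_le[OF s_le, of j] by (auto intro: less_le_trans)
      moreover have "(\<Sum>i<card (B j). d ! i) \<le> (\<Sum>i<(reach d ^^ j) s. d ! i)"
        using B_le[of j] by (intro sum_mono2) auto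
      ultimately have "(\<Sum>x\<in>B j. degree G x) \<le> (\<Sum>i | i \<in> {..<length d} \<and> bfs_level d s i \<le> j. d ! i)"
        using sumB[of j] by simp
      then show ?thesis
        unfolding B_def of_nat_sum[symmetric] of_nat_le_iff .
    qed
  qed (use levR \<open>r > 0\<close> in \<open>auto simp: frac_le\<close>)
  finally show ?thesis
    using that[OF s \<open>r > 0\<close> full] by simp
qed

section \<open>Graphs indexed in breadth-first order\<close>

text \<open>With \<open>g = reach d\<close> this gives uniqueness of breadth-first parents, with
  \<open>g = level_start d\<close> the level to which an index belongs; \<open>ex_interval\<close>
  gives existence in both uses.\<close>

lemma interval_unique:
  fixes g :: "nat \<Rightarrow> nat"
  assumes "mono g" "g a \<le> q" "q < g (Suc a)" "g b \<le> q" "q < g (Suc b)"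
  shows "a = b"
proof (rule ccontr)
  assume "a \<noteq> b"
  then have "Suc a \<le> b \<or> Suc b \<le> a"
    by auto
  then have "g (Suc a) \<le> g b \<or> g (Suc b) \<le> g a"
    using assms(1) by (auto dest: monoD)
  then show False
    using assms by auto
qed

lemma ex_interval:
  fixes g :: "nat \<Rightarrow> nat"
  assumes "g 0 \<le> q" "q < g n"
  shows "\<exists>a<n. g a \<le> q \<and> q < g (Suc a)"
  using assms(2)
proof (induction n)
  case 0
  then show ?case
    using assms(1) by simp
next
  case (Suc n)
  then show ?case
    by (cases "q < g n") (auto simp: less_Suc_eq)
qed

text \<open>The intervals given by \<open>reach\<close> start at 2, so vertex 1, the child of 0
  along the root edge, is added separately.\<close>

definition bfs_child :: "nat list \<Rightarrow> nat \<Rightarrow> nat \<Rightarrow> bool" where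
  "bfs_child d p q \<longleftrightarrow> p = 0 \<and> q = 1 \<or> reach d p \<le> q \<and> q < reach d (Suc p)"

lemma reach_ge_2: "reach d m \<ge> 2"
  by (simp add: reach_def)

context tree_degrees
begin

lemma bfs_child_less:
  assumes "bfs_child d p q" "q < length d"
  shows "p < q"
proof (cases "p = 0 \<and> q = 1")
  case False
  then have "reach d p \<le> q"
    using assms(1) by (auto simp: bfs_child_def)
  moreover have "p < length d"
    using calculation assms(2) monoD[OF mono_reach, of "length d" p d] reach_length
    by (cases "p < length d") auto
  ultimately show ?thesis
    using less_reach[of p] by simp
qed simp

lemma bfs_parent_unique: "bfs_child d p q \<Longrightarrow> bfs_child d p' q \<Longrightarrow> p = p'"
  using reach_ge_2[of d p] reach_ge_2[of d p'] interval_unique[OF mono_reach, of d p q p']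
  by (auto simp: bfs_child_def)

text \<open>For \<open>m\<close> the size of a ball, the bound \<open>p < m\<close> says that a
  vertex in the ball of the next radius has its parent in this ball. With
  \<open>m = length d\<close> it gives every vertex except 0 a parent.\<close>

lemma ex_bfs_parent:
  assumes "0 < q" "q < reach d m" "0 < m"
  shows "\<exists>p<m. bfs_child d p q"
proof (cases "q = 1")
  case False
  then show ?thesis
    using assms ex_interval[of "reach d" q m] by (fastforce simp: bfs_child_def reach_def)
qed (use assms in \<open>auto simp: bfs_child_def\<close>)

lemma not_bfs_child_0: "\<not> bfs_child d p 0"
  using reach_ge_2[of d p] by (auto simp: bfs_child_def)

text \<open>Vertex 0 has the children from 1 up to \<open>d ! 0\<close> and no parent; any other
  vertex \<open>p\<close> has \<open>d ! p - 1\<close> children and one parent.\<close>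

lemma card_bfs_neighbours:
  assumes "p < length d"
  shows "card {q. q < length d \<and> (bfs_child d p q \<or> bfs_child d q p)} = d ! p"
proof -
  have le: "reach d (Suc p) \<le> length d"
    using assms by (intro reach_le) simp
  have "d ! p \<ge> 1"
    using assms by (rule nth_ge_1)
  have "{q. q < length d \<and> (bfs_child d p q \<or> bfs_child d q p)} =
      {q. q < length d \<and> bfs_child d p q} \<union> {q. q < length d \<and> bfs_child d q p}"
    by auto
  moreover have "{q. q < length d \<and> bfs_child d p q} \<inter> {q. q < length d \<and> bfs_child d q p} = {}"
    using bfs_child_less assms less_asym by blast
  ultimately have *: "card {q. q < length d \<and> (bfs_child d p q \<or> bfs_child d q p)} =
      card {q. q < length d \<and> bfs_child d p q} + card {q. q < length d \<and> bfs_child d q p}"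
    by (simp add: card_Un_disjoint)
  show ?thesis
  proof (cases "p = 0")
    case True
    have "{q. q < length d \<and> bfs_child d p q} = {1..<reach d 1}"
      using le length_ge_2 reach_ge_2[of d 1] True by (auto simp: bfs_child_def reach_def)
    moreover have "{q. q < length d \<and> bfs_child d q p} = {}"
      using not_bfs_child_0 True by auto
    ultimately show ?thesis
      using * True \<open>d ! p \<ge> 1\<close> by (simp add: reach_def)
  next
    case False
    have "{q. q < length d \<and> bfs_child d p q} = {reach d p..<reach d (Suc p)}"
      using le False by (auto simp: bfs_child_def)
    moreover obtain p' where "p' < length d" "bfs_child d p' p"
      using ex_bfs_parent[of p "length d"] reach_length assms False by fastforce
    then have "{q. q < length d \<and> bfs_child d q p} = {p'}"
      using bfs_parent_unique by blast
    ultimately show ?thesis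
      using * \<open>d ! p \<ge> 1\<close> by (simp add: reach_Suc)
  qed
qed

end

text \<open>Graphs isomorphic via \<open>idx\<close> to the breadth-first tree on the numbers below
  \<open>length d\<close>. This separates the argument about the greedy tree from its encoding by
  pairs.\<close>

locale bfs_indexed_graph = tree_degrees +
  fixes G :: "'a pair_pre_digraph" and idx :: "'a \<Rightarrow> nat"
  assumes bij: "bij_betw idx (pverts G) {..<length d}"
    and parcs_subset: "parcs G \<subseteq> pverts G \<times> pverts G"
    and arc_iff: "\<And>x y. x \<in> pverts G \<Longrightarrow> y \<in> pverts G \<Longrightarrow>
      (x, y) \<in> parcs G \<longleftrightarrow> bfs_child d (idx x) (idx y) \<or> bfs_child d (idx y) (idx x)"
begin

lemma idx_less: "x \<in> pverts G \<Longrightarrow> idx x < length d"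
  using bij by (auto simp: bij_betw_def)

lemma ex_vertex: "i < length d \<Longrightarrow> \<exists>x\<in>pverts G. idx x = i"
  using bij by (auto simp: bij_betw_def image_iff) (metis imageE lessThan_iff)

lemma idx_eqD: "idx x = idx y \<Longrightarrow> x \<in> pverts G \<Longrightarrow> y \<in> pverts G \<Longrightarrow> x = y"
  using bij by (auto simp: bij_betw_def dest: inj_onD)

lemma is_pair_graph: "pair_graph G"
proof unfold_locales
  show fin: "finite (pverts G)"
    using bij bij_betw_finite by blast
  show "finite (parcs G)"
    by (rule finite_subset[OF parcs_subset]) (use fin in simp)
  show "symmetric (with_proj G)"
    using parcs_subset by (auto simp: symmetric_def sym_def arc_iff)
  show "fst e \<noteq> snd e" if "e \<in> parcs G" for e
  proof -
    have "bfs_child d (idx (fst e)) (idx (snd e)) \<or> bfs_child d (idx (snd e)) (idx (fst e))"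
      using that parcs_subset arc_iff[of "fst e" "snd e"] by (cases e) auto
    moreover have "idx (fst e) < length d" "idx (snd e) < length d"
      using that parcs_subset idx_less by auto
    ultimately show ?thesis
      using bfs_child_less by fastforce
  qed
qed (use parcs_subset in auto)

sublocale pair_graph G
  by (rule is_pair_graph)

text \<open>Every vertex is reachable from the one of index 0, by induction on the index, since
  parents have smaller indices.\<close>

lemma is_connected: "connected (with_proj G)"
proof -
  obtain r where r: "r \<in> pverts G" "idx r = 0"
    using ex_vertex[of 0] length_ge_2 by fastforce
  have reach_r: "r \<rightarrow>\<^sup>*\<^bsub>with_proj G\<^esub> x" if "x \<in> pverts G" for x
    using that
  proof (induction "idx x" arbitrary: x rule: less_induct)
    case less
    show ?case
    proof (cases "idx x = 0")
      case True
      then have "x = r"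
        using idx_eqD r less.prems by simp
      then show ?thesis
        using r by simp
    next
      case False
      then obtain p where p: "p < length d" "bfs_child d p (idx x)"
        using ex_bfs_parent[of "idx x" "length d"] idx_less[OF less.prems] reach_length by fastforce
      then obtain y where y: "y \<in> pverts G" "idx y = p"
        using ex_vertex by blast
      then have "(y, x) \<in> parcs G"
        using p arc_iff less.prems by simp
      moreover have "r \<rightarrow>\<^sup>*\<^bsub>with_proj G\<^esub> y"
        using less.hyps[of y] y p bfs_child_less idx_less[OF less.prems] by blast
      ultimately show ?thesis
        using reachable_adj_trans by simp
    qed
  qed
  show ?thesis
  proof (rule connectedI)
    show "pverts G \<noteq> {}"
      using r by auto
    show "u \<rightarrow>\<^sup>*\<^bsub>with_proj (mk_symmetric (with_proj G))\<^esub> v" if "u \<in> pverts G" "v \<in> pverts G" for u v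
      using reachable_mk_symmetricI[OF reachable_trans[OF symmetric_reachable'[OF reach_r] reach_r]] that
      by simp
  qed
qed

sublocale connected_pair_graph G
  by unfold_locales (rule is_connected)

lemma degree_eq_nth:
  assumes "x \<in> pverts G"
  shows "degree G x = d ! idx x"
proof -
  have nb: "{y. (x, y) \<in> parcs G} \<subseteq> pverts G"
    using parcs_subset by auto
  have "idx ` {y. (x, y) \<in> parcs G} =
      {q. q < length d \<and> (bfs_child d (idx x) q \<or> bfs_child d q (idx x))}"
  proof (intro equalityI subsetI)
    fix q assume "q \<in> {q. q < length d \<and> (bfs_child d (idx x) q \<or> bfs_child d q (idx x))}"
    moreover from this obtain y where "y \<in> pverts G" "idx y = q"
      using ex_vertex by blast
    ultimately show "q \<in> idx ` {y. (x, y) \<in> parcs G}"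
      using arc_iff assms by auto
  qed (use nb arc_iff[OF assms] idx_less in auto)
  moreover have "card (idx ` {y. (x, y) \<in> parcs G}) = card {y. (x, y) \<in> parcs G}"
    using bij nb by (intro card_image) (auto simp: bij_betw_def intro: inj_on_subset)
  ultimately show ?thesis
    using card_bfs_neighbours[OF idx_less[OF assms]] degree_eq_card by simp
qed

lemma awalk_arc_nth:
  assumes "awalk u p v" "i < length p"
  shows "(awalk_verts u p ! i, awalk_verts u p ! Suc i) \<in> parcs G"
  using assms
proof (induction p arbitrary: u i)
  case (Cons e p)
  show ?case
  proof (cases i)
    case 0
    have "awalk_verts (snd e) p ! 0 = snd e"
      using Cons.prems(1) by (cases p) (auto simp: awalk_Cons_iff)
    then show ?thesis
      using Cons.prems(1) 0 by (auto simp: awalk_Cons_iff)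
  next
    case (Suc k)
    then show ?thesis
      using Cons.IH[of "snd e" k] Cons.prems by (auto simp: awalk_Cons_iff)
  qed
qed simp

text \<open>On a cycle, the vertex of maximal index would have two distinct parents.\<close>

lemma cycle_short:
  assumes "cycle p"
  shows "length p < 3"
proof (rule ccontr)
  assume "\<not> length p < 3"
  define k where "k = length p"
  have k: "k \<ge> 3"
    using \<open>\<not> length p < 3\<close> by (simp add: k_def)
  obtain u where u: "awalk u p u" "distinct (tl (awalk_verts u p))"
    using assms by (auto simp: cycle_def)
  define w where "w i = awalk_verts u p ! i" for i
  have len: "length (awalk_verts u p) = Suc k"
    using length_awalk_verts[of u p] by (simp add: k_def)
  have arc: "(w i, w (Suc i)) \<in> parcs G" if "i < k" for i
    using awalk_arc_nth[OF u(1)] that by (simp add: w_def k_def)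
  have closed: "w 0 = w k"
    using len awhd_of_awalk[OF u(1)] awlast_if_cas[of u p u] u(1)
    by (auto simp: w_def hd_conv_nth last_conv_nth awalk_def)
  \<comment> \<open>Positions are taken from 1 to \<open>k\<close> because distinctness holds for
    the tail of the vertex list; position 0 repeats \<open>k\<close>.\<close>
  have inj: "inj_on w {1..k}"
  proof (rule inj_onI)
    fix i j assume ij: "i \<in> {1..k}" "j \<in> {1..k}" "w i = w j"
    then have "tl (awalk_verts u p) ! (i - 1) = tl (awalk_verts u p) ! (j - 1)"
      using len by (auto simp: nth_tl w_def)
    then have "i - 1 = j - 1"
      using nth_eq_iff_index_eq[OF u(2)] ij len by auto
    then show "i = j"
      using ij by auto
  qed
  have "Max ((\<lambda>i. idx (w i)) ` {1..k}) \<in> (\<lambda>i. idx (w i)) ` {1..k}"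
    using k by (intro Max_in) auto
  then obtain m where m: "m \<in> {1..k}" "idx (w m) = Max ((\<lambda>i. idx (w i)) ` {1..k})"
    by auto
  have max: "idx (w i) \<le> idx (w m)" if "i \<in> {1..k}" for i
    unfolding m(2) using that by (intro Max_ge) auto
  \<comment> \<open>\<open>i\<close> and \<open>j\<close> are the cyclic predecessor and successor
    of the maximal position \<open>m\<close>; they differ because \<open>k \<ge> 3\<close>.\<close>
  define i where "i = (if m = 1 then k else m - 1)"
  define j where "j = (if m = k then 1 else m + 1)"
  have ij: "i \<in> {1..k}" "j \<in> {1..k}" "i \<noteq> j"
    using m k by (auto simp: i_def j_def)
  have "(w i, w m) \<in> parcs G"
    using arc[of "m - 1"] m closed by (cases "m = 1") (auto simp: i_def)
  moreover have "(w m, w j) \<in> parcs G"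
    using arc[of "if m = k then 0 else m"] m k closed by (auto simp: j_def)
  then have "(w j, w m) \<in> parcs G"
    using arc_sym by blast
  moreover have "bfs_child d (idx (w l)) (idx (w m))" if "(w l, w m) \<in> parcs G" "l \<in> {1..k}" for l
    using that arc_iff[of "w l" "w m"] bfs_child_less[of "idx (w m)" "idx (w l)"] max[of l]
      idx_less[of "w l"] by (auto dest: in_arcsD1 in_arcsD2)
  ultimately have "idx (w i) = idx (w j)" "w i \<in> pverts G" "w j \<in> pverts G"
    using ij bfs_parent_unique by (blast dest: in_arcsD1)+
  then show False
    using ij idx_eqD inj_onD[OF inj] by blast
qed

sublocale tree_graph G
  by unfold_locales (rule cycle_short)

lemma sum_pverts: "(\<Sum>x\<in>pverts G. f (idx x)) = (\<Sum>i<length d. f i)"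
  by (rule sum.reindex_bij_betw[OF bij])

lemma has_degree_sequence: "has_degree_sequence G d"
proof -
  have "image_mset (degree G) (mset_set (pverts G)) = image_mset (\<lambda>x. d ! idx x) (mset_set (pverts G))"
    using degree_eq_nth pair_finite_verts by (intro image_mset_cong) simp
  also have "\<dots> = image_mset (nth d) (image_mset idx (mset_set (pverts G)))"
    by (simp add: multiset.map_comp comp_def)
  also have "image_mset idx (mset_set (pverts G)) = mset_set {..<length d}"
    using bij by (simp add: image_mset_mset_set bij_betw_def)
  also have "image_mset (nth d) (mset_set {..<length d}) = mset (map (nth d) [0..<length d])"
    by (simp add: lessThan_atLeast0 mset_upt)
  finally show ?thesis
    unfolding has_degree_sequence_def by (simp add: map_nth)
qed

text \<open>Passing from a vertex to its parent leads from each ball to the one of the previous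
  radius, until an index below \<open>s\<close> is reached.\<close>

lemma dist_to_centre:
  assumes "s \<in> {1, 2}" "x \<in> pverts G" "idx x < (reach d ^^ j) s"
  shows "\<exists>c\<in>pverts G. idx c < s \<and> graph_dist G x c \<le> j"
  using assms(2,3)
proof (induction j arbitrary: x)
  case 0
  then show ?case
    by (intro bexI[of _ x]) auto
next
  case (Suc j)
  show ?case
  proof (cases "idx x < s")
    case True
    then show ?thesis
      using Suc.prems by (intro bexI[of _ x]) auto
  next
    case False
    have "(reach d ^^ j) s > 0"
      using assms(1) reach_ge_2[of d] by (cases j) (auto simp: less_le_trans[of 0 2])
    then obtain p where p: "p < (reach d ^^ j) s" "bfs_child d p (idx x)"
      using ex_bfs_parent[of "idx x" "(reach d ^^ j) s"] Suc.prems False assms(1) by auto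
    then have "p < length d"
      using bfs_child_less idx_less[OF Suc.prems(1)] by fastforce
    then obtain y where y: "y \<in> pverts G" "idx y = p"
      using ex_vertex by blast
    then obtain c where c: "c \<in> pverts G" "idx c < s" "graph_dist G y c \<le> j"
      using Suc.IH p by blast
    have "(x, y) \<in> parcs G"
      using arc_iff y p Suc.prems(1) by simp
    then have "graph_dist G x c \<le> Suc j"
      using dist_arc[of x y] dist_triangle[of x y c] Suc.prems(1) y(1) c by simp
    then show ?thesis
      using c by blast
  qed
qed

text \<open>From \<open>x\<close> the centre is reached within \<open>bfs_level d s (idx x)\<close>
  steps, crossing it takes at most \<open>s - 1\<close>, and any \<open>y\<close> is at most
  \<open>r + 1 - s\<close> away from it. The sum \<open>r + bfs_level d s (idx x)\<close> bounds the
  eccentricity of \<open>x\<close>.\<close>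

lemma connective_eccentricity_index_ge:
  assumes s: "s \<in> {1, 2}" and "r > 0" and full: "(reach d ^^ (r + 1 - s)) s \<ge> length d"
  shows "(\<Sum>i<length d. real (d ! i) / real (r + bfs_level d s i)) \<le> connective_eccentricity_index G"
proof -
  have s_le: "s \<le> length d"
    using s length_ge_2 by auto
  have central: "graph_dist G c c' \<le> s - 1"
    if c: "c \<in> pverts G" "c' \<in> pverts G" "idx c < s" "idx c' < s" for c c'
  proof (cases "c = c'")
    case False
    then have "idx c \<noteq> idx c'"
      using idx_eqD c by blast
    then have "s = 2" "bfs_child d (idx c) (idx c') \<or> bfs_child d (idx c') (idx c)"
      using s c by (auto simp: bfs_child_def)
    then show ?thesis
      using arc_iff[OF c(1,2)] dist_arc[of c c'] by simp
  qed (use c in simp)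
  have ecc_le: "eccentricity G x \<le> r + bfs_level d s (idx x)" if x: "x \<in> pverts G" for x
  proof -
    have "graph_dist G x y \<le> r + bfs_level d s (idx x)" if y: "y \<in> pverts G" for y
    proof -
      have "idx x < (reach d ^^ bfs_level d s (idx x)) s"
        using bfs_level_le_iff[OF s_le idx_less[OF x] full] by blast
      then obtain c where c: "c \<in> pverts G" "idx c < s" "graph_dist G x c \<le> bfs_level d s (idx x)"
        using dist_to_centre[OF s x] by blast
      obtain c' where c': "c' \<in> pverts G" "idx c' < s" "graph_dist G y c' \<le> r + 1 - s"
        using dist_to_centre[OF s y less_le_trans[OF idx_less[OF y] full]] by blast
      have "graph_dist G x y \<le> graph_dist G x c + (graph_dist G c c' + graph_dist G c' y)"
        using dist_triangle[of x c y] dist_triangle[of c c' y] x y c(1) c'(1) by simp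
      also have "\<dots> \<le> bfs_level d s (idx x) + ((s - 1) + (r + 1 - s))"
        using c c' central[OF c(1) c'(1) c(2) c'(2)] dist_commute[OF y c'(1)] by simp
      also have "\<dots> = r + bfs_level d s (idx x)"
        using s \<open>r > 0\<close> by auto
      finally show ?thesis .
    qed
    then show ?thesis
      unfolding eccentricity_def using pair_finite_verts pverts_nonempty by simp
  qed
  \<comment> \<open>Division by 0 yields 0, so comparing the fractions requires a positive
    denominator; a vertex of index 0 or 1 other than \<open>x\<close> provides it.\<close>
  have ecc_pos: "eccentricity G x > 0" if x: "x \<in> pverts G" for x
  proof -
    have "(if idx x = 0 then 1 else 0) < length d"
      using length_ge_2 by auto
    then obtain y where y: "y \<in> pverts G" "idx y = (if idx x = 0 then 1 else 0)"
      using ex_vertex by blast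
    then have "graph_dist G x y \<noteq> 0"
      using dist_eq_0_iff[OF x y(1)] by (auto split: if_splits)
    then show ?thesis
      using dist_le_eccentricity[OF y(1), of x] by simp
  qed
  have "(\<Sum>i<length d. real (d ! i) / real (r + bfs_level d s i)) =
      (\<Sum>x\<in>pverts G. real (d ! idx x) / real (r + bfs_level d s (idx x)))"
    by (simp only: sum_pverts[symmetric])
  also have "\<dots> \<le> (\<Sum>x\<in>pverts G. real (degree G x) / real (eccentricity G x))"
  proof (rule sum_mono)
    fix x assume x: "x \<in> pverts G"
    show "real (d ! idx x) / real (r + bfs_level d s (idx x)) \<le> real (degree G x) / real (eccentricity G x)"
      unfolding degree_eq_nth[OF x] using ecc_le[OF x] ecc_pos[OF x]
      by (intro frac_le) (simp_all del: of_nat_add)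
  qed
  finally show ?thesis
    unfolding connective_eccentricity_index_def .
qed

end

section \<open>The greedy tree\<close>

lemma rev_sorted_list_of_multiset_mset:
  fixes xs :: "nat list"
  assumes "sorted_wrt (\<ge>) xs"
  shows "rev (sorted_list_of_multiset (mset xs)) = xs"
proof -
  have "sort xs = rev xs"
    using assms by (intro properties_for_sort) (auto simp: sorted_wrt_rev)
  then show ?thesis
    by simp
qed

text \<open>The number of vertices above level \<open>i\<close>, hence the index of the first vertex
  on that level; for \<open>i = Suc k\<close> it is the size of the ball of radius \<open>k\<close>
  around the root.\<close>

definition level_start :: "nat list \<Rightarrow> nat \<Rightarrow> nat" where
  "level_start d i = (case i of 0 \<Rightarrow> 0 | Suc k \<Rightarrow> (reach d ^^ k) 1)"

definition bfs_index :: "nat list \<Rightarrow> nat \<times> nat \<Rightarrow> nat" where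
  "bfs_index d = (\<lambda>(i, j). level_start d i + j)"

lemma level_start_simps [simp]:
  "level_start d 0 = 0"
  "level_start d (Suc 0) = 1"
  "level_start d (Suc (Suc i)) = reach d (level_start d (Suc i))"
  by (simp_all add: level_start_def)

lemma sum_nth_diff_eq_reach:
  "(\<Sum>i<k. d ! (a + i) - 1) + reach d a = reach d (a + k)"
  by (induction k) (simp_all add: reach_Suc)

context tree_degrees
begin

lemma sum_list_segment:
  assumes "a \<le> b" "b \<le> length d"
  shows "(\<Sum>x\<leftarrow>take (b - a) (drop a d). x - 1) = reach d b - reach d a"
proof -
  have "(\<Sum>x\<leftarrow>take (b - a) (drop a d). x - 1) = (\<Sum>i<b - a. d ! (a + i) - 1)"
    using assms by (simp add: sum_list_sum_nth lessThan_atLeast0)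
  then show ?thesis
    using sum_nth_diff_eq_reach[of d a "b - a"] assms by simp
qed

text \<open>When the first \<open>m\<close> degrees form a ball around the root, the next level has
  width \<open>reach d m - m\<close>, and the entries used for it sum, each minus one, to
  \<open>reach d (reach d m) - reach d m\<close>. By \<open>less_reach\<close> the recursion
  progresses until all degrees are used.\<close>

lemma greedy_levels_eq:
  assumes "m \<le> length d"
  shows "\<exists>K. greedy_levels (reach d m - m) (drop m d) =
      map (\<lambda>i. mset (take ((reach d ^^ Suc i) m - (reach d ^^ i) m) (drop ((reach d ^^ i) m) d))) [0..<K]
    \<and> (reach d ^^ K) m = length d"
  using assms
proof (induction "length d - m" arbitrary: m rule: less_induct)
  case less
  show ?case
  proof (cases "m = length d")
    case True
    then show ?thesis
      by (intro exI[of _ 0]) (simp add: greedy_levels.simps)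
  next
    case False
    then have m: "m < length d" "m < reach d m" "reach d m \<le> length d"
      using less.prems less_reach reach_le by auto
    then have "length d - reach d m < length d - m"
      by linarith
    then obtain K where K: "greedy_levels (reach d (reach d m) - reach d m) (drop (reach d m) d) =
        map (\<lambda>i. mset (take ((reach d ^^ Suc i) (reach d m) - (reach d ^^ i) (reach d m))
          (drop ((reach d ^^ i) (reach d m)) d))) [0..<K]"
      "(reach d ^^ K) (reach d m) = length d"
      using less.hyps m(3) by blast
    have "drop (reach d m - m) (drop m d) = drop (reach d m) d"
      using m by simp
    then have "greedy_levels (reach d m - m) (drop m d) =
        mset (take (reach d m - m) (drop m d)) #
          greedy_levels (reach d (reach d m) - reach d m) (drop (reach d m) d)"
      using m sum_list_segment[of m "reach d m"] by (subst greedy_levels.simps) simp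
    also have "\<dots> = map (\<lambda>i. mset (take ((reach d ^^ Suc i) m - (reach d ^^ i) m)
        (drop ((reach d ^^ i) m) d))) [0..<Suc K]"
      unfolding K(1) map_upt_Suc by (simp add: funpow_swap1)
    finally show ?thesis
      using K(2) by (intro exI[of _ "Suc K"]) (simp add: funpow_swap1)
  qed
qed

lemma greedy_level_degree_sequence_eq:
  obtains K where "greedy_level_degree_sequence d =
      map (\<lambda>i. mset (take (level_start d (Suc i) - level_start d i) (drop (level_start d i) d))) [0..<K]"
    and "level_start d K = length d"
proof -
  obtain a ds where d: "d = a # ds"
    using length_ge_2 by (cases d) auto
  \<comment> \<open>Makes \<open>reach d 1 - 1\<close> equal to \<open>a\<close>, the width of the
    level below the root.\<close>
  have "a \<ge> 1"
    using pos d by simp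
  then have "greedy_level_degree_sequence d = {#a#} # greedy_levels (reach d 1 - 1) (drop 1 d)"
    by (simp add: d reach_def)
  moreover obtain K where "greedy_levels (reach d 1 - 1) (drop 1 d) =
      map (\<lambda>i. mset (take ((reach d ^^ Suc i) 1 - (reach d ^^ i) 1) (drop ((reach d ^^ i) 1) d))) [0..<K]"
    and K: "(reach d ^^ K) 1 = length d"
    using greedy_levels_eq[of 1] length_ge_2 by auto
  ultimately have "greedy_level_degree_sequence d = map (\<lambda>i. mset (take (level_start d (Suc i) - level_start d i)
      (drop (level_start d i) d))) [0..<Suc K]"
    unfolding map_upt_Suc by (simp add: level_start_def d)
  then show ?thesis
    using that[of "Suc K"] K by (simp add: level_start_def)
qed

lemma level_start_le: "level_start d i \<le> length d"
  using length_ge_2 funpow_reach_le[of 1] by (cases i) (auto simp: level_start_def)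

lemma mono_level_start: "mono (level_start d)"
  unfolding incseq_Suc_iff
proof
  fix i
  show "level_start d i \<le> level_start d (Suc i)"
    using less_reach[of "level_start d i"] level_start_le[of i] reach_length
    by (cases i; cases "level_start d i = length d") auto
qed

text \<open>Level \<open>i\<close> carries the segment of \<open>d\<close> from
  \<open>level_start d i\<close> on, which is already sorted. The children of a vertex with index
  \<open>p\<close> below the root level, counted from the start of their level, therefore have the
  indices from \<open>reach d p\<close> up to \<open>reach d (Suc p)\<close>, excluded. The root is
  treated separately.\<close>

lemma bfs_indexed_greedy_tree: "bfs_indexed_graph d (greedy_tree d) (bfs_index d)"
proof unfold_locales
  obtain K where Ls: "greedy_level_degree_sequence d =
      map (\<lambda>i. mset (take (level_start d (Suc i) - level_start d i) (drop (level_start d i) d))) [0..<K]"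
    and K: "level_start d K = length d"
    by (rule greedy_level_degree_sequence_eq)
  define V where "V = pverts (greedy_tree d)"
  have level: "level_start d i \<le> level_start d (Suc i)" for i
    using mono_level_start by (simp add: incseq_Suc_iff)
  have V_iff: "(i, j) \<in> V \<longleftrightarrow> i < K \<and> level_start d i + j < level_start d (Suc i)" for i j
    using level[of i] level_start_le[of "Suc i"]
    by (auto simp: V_def greedy_tree_def level_greedy_tree_def level_greedy_vertices_def Ls less_diff_conv2)
  have degree: "level_degree (greedy_level_degree_sequence d) i j = d ! (level_start d i + j)"
    if "(i, j) \<in> V" for i j
  proof -
    let ?seg = "take (level_start d (Suc i) - level_start d i) (drop (level_start d i) d)"
    have "level_degree (greedy_level_degree_sequence d) i j = rev (sorted_list_of_multiset (mset ?seg)) ! j"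
      using that by (simp add: level_degree_def Ls V_iff del: sorted_list_of_multiset_mset)
    also have "rev (sorted_list_of_multiset (mset ?seg)) = ?seg"
      by (intro rev_sorted_list_of_multiset_mset sorted_wrt_take sorted_wrt_drop sorted)
    also have "?seg ! j = d ! (level_start d i + j)"
      using that level_start_le[of "Suc i"] by (auto simp: V_iff)
    finally show ?thesis .
  qed
  \<comment> \<open>Below the root the down-degree is the degree minus one, the summand of
    \<open>reach\<close>; the root keeps its full degree, whence \<open>i > 0\<close>.\<close>
  have down_sum: "(\<Sum>j'<j. down_degree (greedy_level_degree_sequence d) i j') + reach d (level_start d i) =
      reach d (level_start d i + j)" if "i > 0" "(i, j) \<in> V" for i j
  proof -
    have "(\<Sum>j'<j. down_degree (greedy_level_degree_sequence d) i j') =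
        (\<Sum>j'<j. d ! (level_start d i + j') - 1)"
      using that degree by (intro sum.cong) (auto simp: down_degree_def V_iff)
    then show ?thesis
      using sum_nth_diff_eq_reach by simp
  qed
  have arcs_iff: "(x, y) \<in> level_greedy_arcs (greedy_level_degree_sequence d) \<longleftrightarrow>
      bfs_child d (bfs_index d x) (bfs_index d y)" if "x \<in> V" "y \<in> V" for x y
  proof -
    obtain i j i' k where xy: "x = (i, j)" "y = (i', k)"
      by (cases x, cases y) auto
    have V: "(i, j) \<in> V" "(i', k) \<in> V"
      using that xy by auto
    have "(x, y) \<in> level_greedy_arcs (greedy_level_degree_sequence d) \<longleftrightarrow> i' = Suc i \<and>
        (\<Sum>j'<j. down_degree (greedy_level_degree_sequence d) i j') \<le> k \<and>
        k < (\<Sum>j'<j. down_degree (greedy_level_degree_sequence d) i j') +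
          down_degree (greedy_level_degree_sequence d) i j"
      using V by (auto simp: xy level_greedy_arcs_def V_def greedy_tree_def level_greedy_tree_def)
    also have "\<dots> \<longleftrightarrow> bfs_child d (level_start d i + j) (level_start d i' + k)"
    proof (cases i)
      case 0
      then have j: "j = 0"
        using V by (simp add: V_iff)
      have "d ! 0 \<ge> 1"
        using nth_ge_1[of 0] length_ge_2 by fastforce
      then have r1: "reach d 1 = 1 + d ! 0" "reach d 0 = 2"
        by (auto simp: reach_def)
      have "i' = 1" if "bfs_child d 0 (level_start d i' + k)"
      proof (rule interval_unique[OF mono_level_start, of _ "level_start d i' + k"])
        show "level_start d 1 \<le> level_start d i' + k" "level_start d i' + k < level_start d (Suc 1)"
          using that r1 \<open>d ! 0 \<ge> 1\<close> by (auto simp: bfs_child_def)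
      qed (use V in \<open>auto simp: V_iff\<close>)
      then show ?thesis
        using degree[OF V(1)] 0 j r1 \<open>d ! 0 \<ge> 1\<close> by (auto simp: down_degree_def bfs_child_def)
    next
      case (Suc i0)
      have "level_start d i \<ge> 1"
        using mono_level_start[THEN monoD, of 1 i] Suc by simp
      then have child: "bfs_child d (level_start d i + j) q \<longleftrightarrow>
          reach d (level_start d i + j) \<le> q \<and> q < reach d (Suc (level_start d i + j))" for q
        by (auto simp: bfs_child_def)
      have next_start: "level_start d (Suc i) = reach d (level_start d i)"
        using Suc by simp
      \<comment> \<open>As \<open>p = level_start d i + j\<close> lies on level \<open>i\<close>,
        monotonicity of \<open>reach d\<close> confines its interval of children to level
        \<open>Suc i\<close>.\<close>
      have "i' = Suc i" if "bfs_child d (level_start d i + j) (level_start d i' + k)"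
      proof (rule interval_unique[OF mono_level_start, of _ "level_start d i' + k"])
        have "reach d (level_start d i) \<le> reach d (level_start d i + j)"
          by (rule monoD[OF mono_reach]) simp
        then show "level_start d (Suc i) \<le> level_start d i' + k"
          using that next_start unfolding child by simp
        have "reach d (Suc (level_start d i + j)) \<le> reach d (level_start d (Suc i))"
          using V(1) by (intro monoD[OF mono_reach]) (simp add: V_iff)
        then show "level_start d i' + k < level_start d (Suc (Suc i))"
          using that unfolding child by simp
      qed (use V in \<open>auto simp: V_iff\<close>)
      moreover have "down_degree (greedy_level_degree_sequence d) i j = d ! (level_start d i + j) - 1"
        using degree[OF V(1)] Suc by (simp add: down_degree_def)
      moreover have "(\<Sum>j'<j. down_degree (greedy_level_degree_sequence d) i j') + level_start d (Suc i) =
          reach d (level_start d i + j)"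
        using down_sum[OF _ V(1)] next_start Suc by simp
      ultimately show ?thesis
        unfolding child reach_Suc by (cases "i' = Suc i") auto
    qed
    finally show ?thesis
      by (simp add: xy bfs_index_def)
  qed
  have arcs_subset: "level_greedy_arcs (greedy_level_degree_sequence d) \<subseteq> V \<times> V"
    by (auto simp: V_def greedy_tree_def level_greedy_tree_def level_greedy_arcs_def)
  then show "parcs (greedy_tree d) \<subseteq> pverts (greedy_tree d) \<times> pverts (greedy_tree d)"
    by (auto simp: V_def greedy_tree_def level_greedy_tree_def)
  show "(x, y) \<in> parcs (greedy_tree d) \<longleftrightarrow>
      bfs_child d (bfs_index d x) (bfs_index d y) \<or> bfs_child d (bfs_index d y) (bfs_index d x)"
    if "x \<in> pverts (greedy_tree d)" "y \<in> pverts (greedy_tree d)" for x y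
    using arcs_iff[of x y] arcs_iff[of y x] that by (simp add: V_def greedy_tree_def level_greedy_tree_def)
  show "bij_betw (bfs_index d) (pverts (greedy_tree d)) {..<length d}"
    unfolding bij_betw_def V_def[symmetric]
  proof (intro conjI equalityI subsetI)
    show "inj_on (bfs_index d) V"
    proof (rule inj_onI)
      fix x y assume "x \<in> V" "y \<in> V" "bfs_index d x = bfs_index d y"
      moreover obtain i j i' k where "x = (i, j)" "y = (i', k)"
        by (cases x, cases y) auto
      ultimately show "x = y"
        using interval_unique[OF mono_level_start, of i "level_start d i + j" i']
        by (auto simp: V_iff bfs_index_def)
    qed
    show "q \<in> {..<length d}" if "q \<in> bfs_index d ` V" for q
      using that level_start_le by (auto simp: bfs_index_def V_iff intro: less_le_trans)
    show "q \<in> bfs_index d ` V" if q: "q \<in> {..<length d}" for q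
    proof -
      obtain i where i: "i < K" "level_start d i \<le> q" "q < level_start d (Suc i)"
        using ex_interval[of "level_start d" q K] q K by auto
      then have "(i, q - level_start d i) \<in> V" "bfs_index d (i, q - level_start d i) = q"
        by (auto simp: V_iff bfs_index_def)
      then show ?thesis
        by (metis imageI)
    qed
  qed
qed

end

section \<open>Degree sequences of trees and the one-vertex tree\<close>

lemma (in tree_graph) sum_degree_sequence:
  assumes "has_degree_sequence G d"
  shows "length d = card (pverts G)" "sum_list d + 2 = 2 * length d"
proof -
  have deg: "mset d = image_mset (degree G) (mset_set (pverts G))"
    using assms by (simp add: has_degree_sequence_def)
  show card: "length d = card (pverts G)"
    using arg_cong[OF deg, of size] by simp
  have "sum_list d = (\<Sum>x\<in>pverts G. degree G x)"
    unfolding sum_mset_sum_list[symmetric] deg by (simp add: sum_unfold_sum_mset)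
  then show "sum_list d + 2 = 2 * length d"
    using sum_degree card by simp
qed

lemma tree_degrees_if_tree:
  assumes "tree_graph G" "has_degree_sequence G d" "sorted_wrt (\<ge>) d" "length d \<ge> 2"
  shows "tree_degrees d"
proof -
  interpret tree_graph G
    by fact
  have "x \<ge> 1" if "x \<in> set d" for x
  proof -
    have "x \<in># image_mset (degree G) (mset_set (pverts G))"
      using assms(2) that by (simp add: has_degree_sequence_def)
    then show ?thesis
      using degree_pos sum_degree_sequence(1)[OF assms(2)] assms(4) pair_finite_verts by auto
  qed
  then show ?thesis
    using assms(3,4) sum_degree_sequence(2)[OF assms(2)] by unfold_locales auto
qed

lemma eq_singleton_0_if_tree:
  assumes "tree_graph G" "has_degree_sequence G d" "length d < 2"
  shows "d = [0]"
  using tree_graph.sum_degree_sequence(2)[OF assms(1,2)] assms(3) by (cases d) auto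

lemma greedy_tree_single: "greedy_tree [0] = \<lparr>pverts = {(0, 0)}, parcs = {}\<rparr>"
proof -
  have "level_greedy_vertices [{#0#}] = {(0, 0)}"
    by (auto simp: level_greedy_vertices_def)
  then show ?thesis
    by (auto simp: greedy_tree_def level_greedy_tree_def level_greedy_arcs_def greedy_levels.simps)
qed

lemma undirected_tree_single: "undirected_tree \<lparr>pverts = {v}, parcs = {}\<rparr>"
proof -
  let ?G = "\<lparr>pverts = {v}, parcs = {}\<rparr>"
  interpret pair_graph ?G
    by unfold_locales (auto simp: symmetric_def sym_def)
  have "connected (with_proj ?G)"
    unfolding connected_conv by auto
  moreover have "\<not> cycle p" for p
    by (auto simp: cycle_def awalk_def)
  ultimately show ?thesis
    unfolding undirected_tree_def using pair_graph by blast
qed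

theorem theorem3p7:
  fixes d :: "nat list"
  assumes "tree_degree_sequence d"
    and "sorted_wrt (\<ge>) d"
  shows "undirected_tree (greedy_tree d) \<and> has_degree_sequence (greedy_tree d) d \<and>
    (\<forall>T :: 'a pair_pre_digraph. undirected_tree T \<and> has_degree_sequence T d \<longrightarrow>
       connective_eccentricity_index T \<le> connective_eccentricity_index (greedy_tree d))"
proof -
  obtain S :: "nat pair_pre_digraph" where S: "tree_graph S" "has_degree_sequence S d"
    using assms(1) by (auto simp: tree_degree_sequence_def tree_graph_iff)
  show ?thesis
  proof (cases "length d \<ge> 2")
    case True
    interpret tree_degrees d
      by (rule tree_degrees_if_tree[OF S assms(2) True])
    interpret greedy: bfs_indexed_graph d "greedy_tree d" "bfs_index d"
      by (rule bfs_indexed_greedy_tree)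
    have "connective_eccentricity_index T \<le> connective_eccentricity_index (greedy_tree d)"
      if T: "undirected_tree T" "has_degree_sequence T d" for T :: "'a pair_pre_digraph"
    proof -
      interpret T: tree_graph T
        using T(1) by (simp add: tree_graph_iff)
      \<comment> \<open>The centre of \<open>T\<close> determines \<open>s\<close> and
        \<open>r\<close>; the same pair is then used to bound the index of the greedy tree from
        below.\<close>
      obtain s r where "s \<in> {1, 2}" "r > 0" "(reach d ^^ (r + 1 - s)) s \<ge> length d"
        and le: "connective_eccentricity_index T \<le>
          (\<Sum>i<length d. real (d ! i) / real (r + bfs_level d s i))"
        by (rule T.connective_eccentricity_index_le[OF tree_degrees_axioms T(2)])
      then show ?thesis
        using greedy.connective_eccentricity_index_ge order_trans[OF le] by blast
    qed
    then show ?thesis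
      using greedy.tree_graph_axioms greedy.has_degree_sequence by (auto simp: tree_graph_iff)
  next
    case False
    then have d: "d = [0]"
      using eq_singleton_0_if_tree[OF S] by simp
    have "connective_eccentricity_index T \<le> connective_eccentricity_index (greedy_tree d)"
      if T: "undirected_tree T" "has_degree_sequence T d" for T :: "'a pair_pre_digraph"
    proof -
      interpret T: tree_graph T
        using T(1) by (simp add: tree_graph_iff)
      \<comment> \<open>In the one-vertex case the index of \<open>T\<close> is 0, and that of the
        greedy tree is nonnegative.\<close>
      have "degree T x = 0" if "x \<in> pverts T" for x
      proof -
        have "degree T x \<in># image_mset (degree T) (mset_set (pverts T))"
          using that T.pair_finite_verts by simp
        also have "image_mset (degree T) (mset_set (pverts T)) = mset d"
          using T(2) by (simp add: has_degree_sequence_def)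
        finally show ?thesis
          using d by simp
      qed
      then show ?thesis
        by (simp add: connective_eccentricity_index_def sum_nonneg)
    qed
    then show ?thesis
      using undirected_tree_single[of "(0, 0)"] greedy_tree_single
      by (simp add: d has_degree_sequence_def out_degree_def out_arcs_def)
  qed
qed

end
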